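(* Let $g\in B^2$, and let $f$ satisfy $\langle f,e_\lambda\rangle=\langle g,e_\lambda\rangle$ and $\langle f^2,e_\lambda\rangle=\langle g^2,e_\lambda\rangle$ for all $\lambda\in\mathbb{R}$, so that $f,f^2\in A^2$. Also let $e^{i\theta_f},e^{i\theta_g}\in U$, with $\langle e^{i\theta_f},e_\lambda\rangle=\langle e^{i\theta_g},e_\lambda\rangle$ for all $\lambda\in\mathbb{R}$, and let $e^{i\theta_{g_N}}$ be a sequence of Bohr functions such that $e^{i\theta_{g_N}}\to e^{i\theta_g}$ in $B^2$ as $N\to\infty$. Then we have the following. (a) $f\in B^2$ if and only if $f$ is not CNS (not concentrated on a null set). (b) If the maps $h\mapsto e^{i\theta_f}h$ and $h\mapsto e^{i\theta_g}h$ are bounded operators on $A^2$, then $f\in B^2$.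
   Context: Throughout, $f,g\in L_{2,\mathrm{loc}}(\mathbb{R}^+)$ are complex-valued. Write $$\langle f,g\rangle=\lim_{T\to\infty}\frac1T\int_0^Tf(t)\overline{g(t)}\,dt,\qquad\|f\|=\sqrt{\langle f,f\rangle}$$ when the limits exist, $e_\lambda(t)=e^{i\lambda t}$ $(\lambda\in\mathbb{R})$, and $\theta_f=\arg f$ (similarly $\theta_g=\arg g$, $\theta_{g_N}=\arg g_N$), so $f=|f|e^{i\theta_f}$. A Bohr (almost-periodic) function is a function with a uniformly convergent generalised Fourier series $\sum_{\lambda\in\mathbb{R}}c_\lambda e_\lambda$; it is necessarily bounded and continuous, and its coefficients $c_\lambda$ are its inner products with $e_\lambda$. $B^2=B^2(\mathbb{R}^+)$ is the Hilbert space of Besicovitch almost-periodic functions on $\mathbb{R}^+$: the closure of the space of Bohr functions in the seminorm $\|\cdot\|$, i.e. $f\in B^2$ if for every $\epsilon>0$ there is a Bohr function $h$ with $\limsup_{T\to\infty}\frac1T\int_0^T|f-h|^2dt<\epsilon$, functions differing by $\phi$ with $\|\phi\|=0$ being identified. "$f_N\to f$ in $B^2$" means $\|f-f_N\|\to0$. $U=\{u\in B^2:|u|=1\}$. $E=\{e_\lambda:\lambda\in\mathbb{R}\}$ and $E^\perp$ is the set of $\phi$ with $\langle\phi,e_\lambda\rangle=0$ for all $\lambda\in\mathbb{R}$. $A^2=A^2(\mathbb{R}^+)$ is the Hilbert space of equivalence classes $\phi+f$ with $\phi\in E^\perp$, where $f$ satisfies $\|f\|_{A^2}^2=\sum_{\lambda\in\mathbb{R}}|\langle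 f,e_\lambda\rangle|^2<\infty$, with inner product $\langle f,g\rangle_{A^2}=\sum_{\lambda\in\mathbb{R}}\langle f,e_\lambda\rangle\overline{\langle g,e_\lambda\rangle}$. A Lebesgue measurable set $S\subseteq\mathbb{R}^+$ is null if $\lim_{T\to\infty}\mathrm{meas}(S\cap[0,T])/T=0$. A function $f$ is not concentrated on a null set (not CNS) if for every null set $S$, $\int_{S\cap[0,T]}|f|^2dt=o\big(\int_0^T|f|^2dt\big)$ as $T\to\infty$.
   Formalization: Part (a) is stated only when ‖f‖ is not 0: for f = g = e^{-t} all hypotheses hold and f is in B² (zero class), yet f is concentrated on the null set [0,1]. The remark that f, f² lie in A² is neither assumed nor asserted. *)

theory Defs
  imports "HOL-Analysis.Analysis" "HOL-Library.Landau_Symbols"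
begin

text \<open>
  Functions on the half-line are total functions on the reals of which only the values on
  \<open>{0..}\<close> matter.  The Hilbert spaces of the theory are represented by the sets of their
  representatives; no quotient is formed.
\<close>

definition L2_loc :: "(real \<Rightarrow> complex) set" where
  "L2_loc = {f. f \<in> borel_measurable (lebesgue_on {0..}) \<and>
                (\<forall>T>0. integrable (lebesgue_on {0..T}) (\<lambda>t. (cmod (f t))\<^sup>2))}"

definition mean_upto :: "real \<Rightarrow> (real \<Rightarrow> 'a) \<Rightarrow> 'a::{banach, second_countable_topology}" where
  "mean_upto T f = (1 / T) *\<^sub>R (LINT t|lebesgue_on {0..T}. f t)"

definition has_binner :: "(real \<Rightarrow> complex) \<Rightarrow> (real \<Rightarrow> complex) \<Rightarrow> complex \<Rightarrow> bool" where
  "has_binner f g c \<longleftrightarrow> ((\<lambda>T. mean_upto T (\<lambda>t. f t * cnj (g t))) \<longlongrightarrow> c) at_top"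

text \<open>The value of \<open>binner\<close> is meaningful only where \<open>has_binner\<close> asserts that the limit exists.\<close>

definition binner :: "(real \<Rightarrow> complex) \<Rightarrow> (real \<Rightarrow> complex) \<Rightarrow> complex" where
  "binner f g = Lim at_top (\<lambda>T. mean_upto T (\<lambda>t. f t * cnj (g t)))"

definition has_bnorm :: "(real \<Rightarrow> complex) \<Rightarrow> real \<Rightarrow> bool" where
  "has_bnorm f r \<longleftrightarrow> 0 \<le> r \<and> has_binner f f (complex_of_real (r\<^sup>2))"

definition e :: "real \<Rightarrow> real \<Rightarrow> complex" where
  "e l t = cis (l * t)"

text \<open>
  The generalised Fourier series is summed along some enumeration of distinct frequencies
  (zero coefficients are allowed, so trigonometric polynomials are included).
\<close>

definition Bohr :: "(real \<Rightarrow> complex) set" where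
  "Bohr = {h. \<exists>(l :: nat \<Rightarrow> real) (c :: nat \<Rightarrow> complex). inj l \<and>
              uniform_limit {0..} (\<lambda>n t. \<Sum>k<n. c k * e (l k) t) h sequentially}"

definition B2 :: "(real \<Rightarrow> complex) set" where
  "B2 = {f \<in> L2_loc. \<forall>\<epsilon>>0. \<exists>h\<in>Bohr.
           Limsup at_top (\<lambda>T. ereal (mean_upto T (\<lambda>t. (cmod (f t - h t))\<^sup>2))) < ereal \<epsilon>}"

definition converges_in_B2 :: "(nat \<Rightarrow> real \<Rightarrow> complex) \<Rightarrow> (real \<Rightarrow> complex) \<Rightarrow> bool" where
  "converges_in_B2 F f \<longleftrightarrow>
     (\<exists>r. (\<forall>N. has_bnorm (\<lambda>t. f t - F N t) (r N)) \<and> r \<longlonglongrightarrow> 0)"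

definition U :: "(real \<Rightarrow> complex) set" where
  "U = {u \<in> B2. \<forall>t\<ge>0. cmod (u t) = 1}"

text \<open>
  A choice of argument.  At zeros of the function the angle is left free, so a statement
  about all such angles covers every convention for the argument of 0.
\<close>

definition is_arg :: "(real \<Rightarrow> real) \<Rightarrow> (real \<Rightarrow> complex) \<Rightarrow> bool" where
  "is_arg \<theta> f \<longleftrightarrow> (\<forall>t\<ge>0. f t = complex_of_real (cmod (f t)) * cis (\<theta> t))"

text \<open>
  Adding a function orthogonal to all \<open>e l\<close> changes neither membership in \<open>A2\<close> nor
  \<open>A2_norm\<close>, so these are the representatives of the classes and their norms.
\<close>

definition A2 :: "(real \<Rightarrow> complex) set" where
  "A2 = {h \<in> L2_loc. (\<forall>l. \<exists>c. has_binner h (e l) c) \<and>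
                     (\<lambda>l. (cmod (binner h (e l)))\<^sup>2) summable_on UNIV}"

definition A2_norm :: "(real \<Rightarrow> complex) \<Rightarrow> real" where
  "A2_norm h = sqrt (\<Sum>\<^sub>\<infinity>l\<in>UNIV. (cmod (binner h (e l)))\<^sup>2)"

text \<open>
  Multiplication by \<open>u\<close> is a bounded operator on classes.  Independence of the
  representative is included: the bound sends functions of norm 0, i.e. those orthogonal to
  all \<open>e l\<close>, to functions of norm 0.
\<close>

definition bounded_multiplier_A2 :: "(real \<Rightarrow> complex) \<Rightarrow> bool" where
  "bounded_multiplier_A2 u \<longleftrightarrow>
     (\<exists>C. \<forall>h\<in>A2. (\<lambda>t. u t * h t) \<in> A2 \<and> A2_norm (\<lambda>t. u t * h t) \<le> C * A2_norm h)"

definition density_null :: "real set \<Rightarrow> bool" where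
  "density_null S \<longleftrightarrow> S \<in> sets lebesgue \<and> S \<subseteq> {0..} \<and>
     ((\<lambda>T. measure lebesgue (S \<inter> {0..T}) / T) \<longlongrightarrow> 0) at_top"

definition not_CNS :: "(real \<Rightarrow> complex) \<Rightarrow> bool" where
  "not_CNS f \<longleftrightarrow> (\<forall>S. density_null S \<longrightarrow>
     (\<lambda>T. LINT t|lebesgue_on (S \<inter> {0..T}). (cmod (f t))\<^sup>2)
       \<in> o[at_top](\<lambda>T. LINT t|lebesgue_on {0..T}. (cmod (f t))\<^sup>2))"

end

theory Submission imports Defs begin

text \<open>
  The whole difficulty is that the coefficients of \<open>f\<close> control it only against trigonometric
  polynomials, so that \<open>f\<close> may carry extra mass on a sparse set, invisible to all frequencies. If
  the mean squares of \<open>f\<close> and \<open>g\<close> agree there is no such mass: \<open>f - g\<close> is then orthogonal to \<open>g\<close>,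
  hence \<open>\<parallel>f - g\<parallel>\<^sup>2 = \<parallel>f\<parallel>\<^sup>2 - \<parallel>g\<parallel>\<^sup>2 = 0\<close> and \<open>f \<in> B2\<close> (lemma \<open>B2_if_same_mean_sq\<close>).
  
  The mean squares are compared through the phases \<open>u = cis \<theta>f\<close> and \<open>v = cis \<theta>g\<close>. As elements of \<open>B2\<close>
  with equal coefficients they satisfy \<open>\<parallel>u - v\<parallel> = 0\<close>, and
  \<open>\<bar>f\<bar>\<^sup>2 - \<bar>g\<bar>\<^sup>2 = (f\<^sup>2 - g\<^sup>2) P + f\<^sup>2 (cnj u\<^sup>2 - P) - g\<^sup>2 (cnj v\<^sup>2 - P)\<close>
  for every \<open>P\<close>. The function \<open>f\<^sup>2 - g\<^sup>2\<close> is orthogonal to all frequencies, and \<open>g \<in> B2\<close> is uniformly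
  integrable, so the last term is harmless for any bounded \<open>P\<close> close to \<open>cnj v\<^sup>2\<close> in the mean.
  
  In part (a), \<open>P\<close> is the conjugate square of a bounded trigonometric polynomial close to \<open>v\<close>, obtained
  from a unimodular Bohr approximation. The first term averages to 0, and the second is
  small compared with the mean square of \<open>f\<close> if \<open>f\<close> does not concentrate on sets of small density. For a
  function that is not concentrated on null sets this stronger property is proved by pasting
  together a bad null set from sets of small density (lemma \<open>not_CNS_uniform\<close>). Conversely, a function
  in \<open>B2\<close> is uniformly integrable, and if its norm is not 0, its mean square stays away from 0.
  
  In part (b), \<open>P = cnj u\<^sup>2\<close>, which removes the second term. A bounded multiplier maps functions
  orthogonal to all frequencies to such functions, and by conjugation the same is true of \<open>cnj u\<close>, so
  the first term again averages to 0. Since \<open>f\<^sup>2 - g\<^sup>2\<close> need not be locally square integrable, it is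
  first truncated in a way that no average notices (lemma \<open>exists_L2_loc_close_in_mean\<close>).
\<close>

section \<open>Local integrability and averages\<close>

definition loc_int :: "(real \<Rightarrow> 'a::{banach, second_countable_topology}) \<Rightarrow> bool" where
  "loc_int f \<longleftrightarrow> (\<forall>T>0. integrable (lebesgue_on {0..T}) f)"

abbreviation half_measurable :: "(real \<Rightarrow> 'a::topological_space) \<Rightarrow> bool" where
  "half_measurable f \<equiv> f \<in> borel_measurable (lebesgue_on {0..})"

abbreviation mean_sq :: "real \<Rightarrow> (real \<Rightarrow> complex) \<Rightarrow> real" where
  "mean_sq T f \<equiv> mean_upto T (\<lambda>t. (cmod (f t))\<^sup>2)"

lemma half_measurable_upto:
  assumes "half_measurable f" shows "f \<in> borel_measurable (lebesgue_on {0..T})"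
  by (rule measurable_restrict_mono[OF assms]) auto

lemma loc_int_add:
  assumes "loc_int f" "loc_int g" shows "loc_int (\<lambda>t. f t + g t)"
  using assms unfolding loc_int_def by auto

lemma loc_int_diff:
  assumes "loc_int f" "loc_int g" shows "loc_int (\<lambda>t. f t - g t)"
  using assms unfolding loc_int_def by auto

lemma loc_int_mult_left:
  fixes c :: "'a::{real_normed_field, banach, second_countable_topology}"
  assumes "loc_int f" shows "loc_int (\<lambda>t. c * f t)"
  using assms unfolding loc_int_def by auto

lemma loc_int_const: "loc_int (\<lambda>t. c)"
  unfolding loc_int_def by (auto intro!: finite_measure.integrable_const finite_measure_lebesgue_on)

lemma loc_int_norm:
  assumes "loc_int f" shows "loc_int (\<lambda>t. norm (f t))"
  using assms unfolding loc_int_def by auto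

lemma loc_int_bound:
  assumes "half_measurable f" "loc_int g" "\<And>t. 0 \<le> t \<Longrightarrow> norm (f t) \<le> g t"
  shows "loc_int f"
  unfolding loc_int_def
proof (intro allI impI)
  fix T :: real assume "T > 0"
  show "integrable (lebesgue_on {0..T}) f"
  proof (rule Bochner_Integration.integrable_bound)
    show "integrable (lebesgue_on {0..T}) g" using assms(2) \<open>T > 0\<close> by (auto simp: loc_int_def)
    show "f \<in> borel_measurable (lebesgue_on {0..T})" by (rule half_measurable_upto[OF assms(1)])
    show "AE t in lebesgue_on {0..T}. norm (f t) \<le> norm (g t)"
    proof (rule AE_I2)
      fix t assume "t \<in> space (lebesgue_on {0..T})"
      then have "0 \<le> t" by auto
      from assms(3)[OF this] show "norm (f t) \<le> norm (g t)"
        by (simp add: order.trans[OF _ abs_ge_self])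
    qed
  qed
qed

lemma mean_upto_cong:
  assumes "\<And>t. 0 \<le> t \<Longrightarrow> f t = g t" shows "mean_upto T f = mean_upto T g"
  unfolding mean_upto_def using assms by (intro arg_cong2[where f=scaleR] Bochner_Integration.integral_cong) auto

lemma mean_upto_add:
  assumes "loc_int f" "loc_int g" "T > 0"
  shows "mean_upto T (\<lambda>t. f t + g t) = mean_upto T f + mean_upto T g"
  using assms by (simp add: mean_upto_def loc_int_def scaleR_add_right)

lemma mean_upto_diff:
  assumes "loc_int f" "loc_int g" "T > 0"
  shows "mean_upto T (\<lambda>t. f t - g t) = mean_upto T f - mean_upto T g"
  using assms by (simp add: mean_upto_def loc_int_def scaleR_diff_right)

lemma mean_upto_mult_left:
  fixes c :: "'a::{real_normed_field, banach, second_countable_topology}"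
  shows "mean_upto T (\<lambda>t. c * f t) = c * mean_upto T f"
  by (simp add: mean_upto_def)

lemma mean_upto_const: "T > 0 \<Longrightarrow> mean_upto T (\<lambda>t. c) = c"
  by (simp add: mean_upto_def lebesgue_integral_const measure_restrict_space)

lemma mean_upto_mono:
  fixes f g :: "real \<Rightarrow> real"
  assumes "loc_int f" "loc_int g" "T > 0" "\<And>t. 0 \<le> t \<Longrightarrow> f t \<le> g t"
  shows "mean_upto T f \<le> mean_upto T g"
proof -
  have "(LINT t|lebesgue_on {0..T}. f t) \<le> (LINT t|lebesgue_on {0..T}. g t)"
    by (rule integral_mono) (use assms in \<open>auto simp: loc_int_def\<close>)
  with assms(3) show ?thesis by (simp add: mean_upto_def divide_right_mono)
qed

lemma mean_upto_nonneg:
  fixes f :: "real \<Rightarrow> real"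
  assumes "\<And>t. 0 \<le> t \<Longrightarrow> 0 \<le> f t" "T > 0"
  shows "0 \<le> mean_upto T f"
proof -
  have "0 \<le> (LINT t|lebesgue_on {0..T}. f t)"
    by (rule Bochner_Integration.integral_nonneg) (use assms in auto)
  with assms(2) show ?thesis by (simp add: mean_upto_def)
qed

lemma norm_mean_upto_le:
  assumes "T > 0"
  shows "norm (mean_upto T f) \<le> mean_upto T (\<lambda>t. norm (f t))"
proof -
  have "norm (LINT t|lebesgue_on {0..T}. f t) \<le> (LINT t|lebesgue_on {0..T}. norm (f t))"
    by (rule integral_norm_bound)
  then have "norm (1 / T) * norm (LINT t|lebesgue_on {0..T}. f t)
      \<le> norm (1 / T) * (LINT t|lebesgue_on {0..T}. norm (f t))"
    by (rule mult_left_mono) simp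
  with assms show ?thesis unfolding mean_upto_def norm_scaleR by simp
qed

lemma norm_mean_upto_le_mean:
  assumes "half_measurable f" "loc_int g" "\<And>t. 0 \<le> t \<Longrightarrow> norm (f t) \<le> g t" "T > 0"
  shows "norm (mean_upto T f) \<le> mean_upto T g"
proof -
  have "norm (mean_upto T f) \<le> mean_upto T (\<lambda>t. norm (f t))" by (rule norm_mean_upto_le[OF assms(4)])
  also have "\<dots> \<le> mean_upto T g"
    by (rule mean_upto_mono[OF loc_int_norm[OF loc_int_bound[OF assms(1-3)]] assms(2,4,3)])
  finally show ?thesis .
qed

lemma mean_upto_of_real: "mean_upto T (\<lambda>t. complex_of_real (f t)) = complex_of_real (mean_upto T f)"
  by (simp add: mean_upto_def scaleR_conv_of_real)

lemma mean_upto_cnj: "mean_upto T (\<lambda>t. cnj (f t)) = cnj (mean_upto T f)"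
  by (simp add: mean_upto_def)

lemma const_divide_tendsto_0: "((\<lambda>T. c / T) \<longlongrightarrow> (0 :: real)) at_top"
  by (rule tendsto_divide_0[OF tendsto_const]) (simp add: filterlim_at_top_imp_at_infinity filterlim_ident)

lemma has_bnorm_0_if_mean_sq_tendsto_0:
  assumes "((\<lambda>T. mean_sq T f) \<longlongrightarrow> 0) at_top" shows "has_bnorm f 0"
  using tendsto_of_real[OF assms, where 'a=complex]
  by (simp add: has_bnorm_def has_binner_def mean_upto_of_real[symmetric] complex_norm_square del: of_real_power)

lemma L2_loc_measurable: "f \<in> L2_loc \<Longrightarrow> half_measurable f"
  by (simp add: L2_loc_def)

lemma L2_loc_loc_int_sq: "f \<in> L2_loc \<Longrightarrow> loc_int (\<lambda>t. (cmod (f t))\<^sup>2)"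
  by (simp add: L2_loc_def loc_int_def)

lemma L2_locI: "half_measurable f \<Longrightarrow> loc_int (\<lambda>t. (cmod (f t))\<^sup>2) \<Longrightarrow> f \<in> L2_loc"
  by (simp add: L2_loc_def loc_int_def)

lemma cmod_add_sq_le: "(cmod (a + b))\<^sup>2 \<le> 2 * (cmod a)\<^sup>2 + 2 * (cmod b)\<^sup>2"
proof -
  have "(cmod (a + b))\<^sup>2 \<le> (cmod a + cmod b)\<^sup>2" by (simp add: norm_triangle_ineq power_mono)
  also have "\<dots> \<le> 2 * (cmod a)\<^sup>2 + 2 * (cmod b)\<^sup>2"
    using sum_squares_bound[of "cmod a" "cmod b"] by (simp add: power2_sum)
  finally show ?thesis .
qed

lemma cmod_diff_sq_le: "(cmod (a - b))\<^sup>2 \<le> 2 * (cmod (a - c))\<^sup>2 + 2 * (cmod (c - b))\<^sup>2"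
  using cmod_add_sq_le[of "a - c" "c - b"] by simp

lemma L2_loc_bounded:
  assumes "half_measurable f" "\<And>t. 0 \<le> t \<Longrightarrow> cmod (f t) \<le> B"
  shows "f \<in> L2_loc"
proof (rule L2_locI[OF assms(1)])
  have [measurable]: "half_measurable f" by (rule assms(1))
  have "norm ((cmod (f t))\<^sup>2) \<le> B\<^sup>2" if "0 \<le> t" for t
    using power_mono[OF assms(2)[OF that], of 2] by simp
  then show "loc_int (\<lambda>t. (cmod (f t))\<^sup>2)"
    by (intro loc_int_bound[OF _ loc_int_const[of "B\<^sup>2"]]) simp_all
qed

lemma L2_loc_add:
  assumes "f \<in> L2_loc" "g \<in> L2_loc" shows "(\<lambda>t. f t + g t) \<in> L2_loc"
proof -
  have [measurable]: "half_measurable f" "half_measurable g" using assms by (auto dest: L2_loc_measurable)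
  have "loc_int (\<lambda>t. 2 * (cmod (f t))\<^sup>2 + 2 * (cmod (g t))\<^sup>2)"
    by (intro loc_int_add loc_int_mult_left L2_loc_loc_int_sq assms)
  from loc_int_bound[OF _ this, of "\<lambda>t. (cmod (f t + g t))\<^sup>2"]
  show ?thesis by (intro L2_locI) (simp_all add: cmod_add_sq_le)
qed

lemma L2_loc_uminus: "f \<in> L2_loc \<Longrightarrow> (\<lambda>t. - f t) \<in> L2_loc"
  by (auto simp: L2_loc_def)

lemma L2_loc_diff: "f \<in> L2_loc \<Longrightarrow> g \<in> L2_loc \<Longrightarrow> (\<lambda>t. f t - g t) \<in> L2_loc"
  using L2_loc_add[OF _ L2_loc_uminus, of f g] by simp

lemma half_measurable_cnj:
  assumes "half_measurable f" shows "half_measurable (\<lambda>t. cnj (f t))"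
proof -
  have "cnj \<in> borel_measurable borel"
    by (intro borel_measurable_continuous_onI continuous_on_cnj continuous_on_id)
  from measurable_compose[OF assms this] show ?thesis .
qed

lemma L2_loc_cnj:
  assumes "f \<in> L2_loc" shows "(\<lambda>t. cnj (f t)) \<in> L2_loc"
  by (rule L2_locI[OF half_measurable_cnj[OF L2_loc_measurable[OF assms]]])
    (simp only: complex_mod_cnj L2_loc_loc_int_sq[OF assms])

lemma L2_loc_mult_bounded:
  assumes "f \<in> L2_loc" "half_measurable u" "\<And>t. 0 \<le> t \<Longrightarrow> cmod (u t) \<le> B"
  shows "(\<lambda>t. u t * f t) \<in> L2_loc"
proof -
  have [measurable]: "half_measurable f" "half_measurable u" using assms by (auto dest: L2_loc_measurable)
  have "norm ((cmod (u t * f t))\<^sup>2) \<le> B\<^sup>2 * (cmod (f t))\<^sup>2" if "0 \<le> t" for t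
    using mult_right_mono[OF power_mono[OF assms(3)[OF that], of 2], of "(cmod (f t))\<^sup>2"]
    by (simp add: norm_mult power_mult_distrib)
  then have "loc_int (\<lambda>t. (cmod (u t * f t))\<^sup>2)"
    by (intro loc_int_bound[OF _ loc_int_mult_left[OF L2_loc_loc_int_sq[OF assms(1)], of "B\<^sup>2"]]) simp_all
  then show ?thesis by (intro L2_locI) simp_all
qed

lemma L2_loc_loc_int_mult:
  assumes "f \<in> L2_loc" "g \<in> L2_loc" shows "loc_int (\<lambda>t. f t * g t)"
proof -
  have [measurable]: "half_measurable f" "half_measurable g" using assms by (auto dest: L2_loc_measurable)
  have "norm (f t * g t) \<le> (cmod (f t))\<^sup>2 + (cmod (g t))\<^sup>2" for t
    using sum_squares_bound[of "cmod (f t)" "cmod (g t)"]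
      mult_nonneg_nonneg[of "cmod (f t)" "cmod (g t)"] norm_ge_zero[of "f t"] norm_ge_zero[of "g t"]
    unfolding norm_mult by linarith
  then show ?thesis
    by (intro loc_int_bound[OF _ loc_int_add[OF assms[THEN L2_loc_loc_int_sq]]]) simp_all
qed

lemma L2_loc_loc_int: "f \<in> L2_loc \<Longrightarrow> loc_int f"
  using L2_loc_loc_int_mult[of f "\<lambda>_. 1"] L2_loc_bounded[of "\<lambda>_. 1" 1] by simp

section \<open>Trigonometric polynomials\<close>

lemma e_measurable [measurable]: "half_measurable (e l)"
proof -
  have "continuous_on {0..} (e l)" unfolding e_def cis_conv_exp by (intro continuous_intros)
  then show ?thesis by (intro continuous_imp_measurable_on_sets_lebesgue) auto
qed

lemma cmod_e [simp]: "cmod (e l t) = 1" by (simp add: e_def)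
lemma cnj_e: "cnj (e l t) = e (- l) t" by (simp add: e_def cis_cnj)
lemma e_mult: "e l t * e m t = e (l + m) t" by (simp add: e_def cis_mult distrib_right)

text \<open>
  The frequencies may repeat, so that sums and products of trigonometric polynomials need no
  collection of terms.
\<close>
inductive trig_poly :: "(real \<Rightarrow> complex) \<Rightarrow> bool" where
  trig_poly_zero: "trig_poly (\<lambda>t. 0)"
| trig_poly_add_term: "trig_poly Q \<Longrightarrow> trig_poly (\<lambda>t. c * e l t + Q t)"

lemma trig_poly_add: "trig_poly P \<Longrightarrow> trig_poly Q \<Longrightarrow> trig_poly (\<lambda>t. P t + Q t)"
  by (induction rule: trig_poly.induct) (auto simp: add.assoc intro: trig_poly.intros)

lemma trig_poly_mult_term: "trig_poly Q \<Longrightarrow> trig_poly (\<lambda>t. c * e l t * Q t)"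
proof (induction rule: trig_poly.induct)
  case (trig_poly_add_term Q d m)
  have "c * e l t * (d * e m t + Q t) = (c * d) * e (l + m) t + c * e l t * Q t" for t
    unfolding e_mult[symmetric] by (simp add: algebra_simps)
  then show ?case using trig_poly.trig_poly_add_term[OF trig_poly_add_term.IH] by simp
qed (simp add: trig_poly_zero)

lemma trig_poly_mult: "trig_poly P \<Longrightarrow> trig_poly Q \<Longrightarrow> trig_poly (\<lambda>t. P t * Q t)"
proof (induction rule: trig_poly.induct)
  case (trig_poly_add_term P c l)
  then show ?case using trig_poly_add[OF trig_poly_mult_term] by (simp add: distrib_right)
qed (simp add: trig_poly_zero)

lemma trig_poly_cnj: "trig_poly P \<Longrightarrow> trig_poly (\<lambda>t. cnj (P t))"
  by (induction rule: trig_poly.induct) (auto simp: cnj_e intro: trig_poly.intros)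

lemma trig_poly_bounded: "trig_poly P \<Longrightarrow> \<exists>B\<ge>0. \<forall>t. cmod (P t) \<le> B"
proof (induction rule: trig_poly.induct)
  case (trig_poly_add_term Q c l)
  then obtain B where B: "B \<ge> 0" "\<forall>t. cmod (Q t) \<le> B" by auto
  have "cmod (c * e l t + Q t) \<le> cmod c + B" for t
    using norm_triangle_ineq[of "c * e l t" "Q t"] B(2)[rule_format, of t] by (simp add: norm_mult)
  with B(1) show ?case by (intro exI[of _ "cmod c + B"]) auto
qed auto

lemma trig_poly_measurable: "trig_poly P \<Longrightarrow> half_measurable P"
  by (induction rule: trig_poly.induct) auto

lemma trig_poly_L2_loc: "trig_poly P \<Longrightarrow> P \<in> L2_loc"
  using trig_poly_bounded[of P] trig_poly_measurable[of P] L2_loc_bounded[of P] by blast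

text \<open>
  The primitive of \<open>e l\<close> is bounded by \<open>2 / \<bar>l\<bar>\<close>, so its average is of order \<open>1 / T\<close>.
\<close>
lemma mean_e_tendsto_0:
  assumes "l \<noteq> 0" shows "((\<lambda>T. mean_upto T (e l)) \<longlongrightarrow> 0) at_top"
proof (rule Lim_null_comparison)
  have "norm (mean_upto T (e l)) \<le> (2 / \<bar>l\<bar>) / T" if "T > 0" for T
  proof -
    have "(LINT t|lebesgue_on {0..T}. e l t) = integral {0..T} (e l)"
      by (intro lebesgue_integral_eq_integral L2_loc_loc_int[THEN loc_int_def[THEN iffD1], rule_format]
          L2_loc_bounded[where B=1] that) auto
    also have "(e l has_integral (e l T / (\<i> * l) - e l 0 / (\<i> * l))) {0..T}"
    proof (rule fundamental_theorem_of_calculus)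
      show "((\<lambda>t. e l t / (\<i> * l)) has_vector_derivative e l t) (at t within {0..T})" for t
      proof -
        have "((\<lambda>z. exp (\<i> * l * z) / (\<i> * l)) has_field_derivative exp (\<i> * l * complex_of_real t))
            (at (complex_of_real t))"
          using assms by (auto intro!: derivative_eq_intros)
        from has_vector_derivative_real_field[OF this]
        show ?thesis by (simp add: e_def cis_conv_exp mult.assoc)
      qed
    qed (use that in auto)
    then have "integral {0..T} (e l) = e l T / (\<i> * l) - e l 0 / (\<i> * l)" by (rule integral_unique)
    finally have "norm (LINT t|lebesgue_on {0..T}. e l t) \<le> norm (e l T / (\<i> * l)) + norm (e l 0 / (\<i> * l))"
      by (simp only: norm_triangle_ineq4)
    also have "\<dots> = 2 / \<bar>l\<bar>" by (simp add: norm_divide norm_mult)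
    finally have "norm (LINT t|lebesgue_on {0..T}. e l t) / T \<le> 2 / \<bar>l\<bar> / T"
      by (rule divide_right_mono) (use that in simp)
    then show ?thesis using that by (simp add: mean_upto_def)
  qed
  then show "\<forall>\<^sub>F T in at_top. norm (mean_upto T (e l)) \<le> (2 / \<bar>l\<bar>) / T"
    using eventually_gt_at_top[of 0] by (rule eventually_mono[rotated])
  show "((\<lambda>T. 2 / \<bar>l\<bar> / T) \<longlongrightarrow> 0) at_top"
    by (rule const_divide_tendsto_0)
qed

lemma trig_poly_mean: "trig_poly P \<Longrightarrow> \<exists>c. ((\<lambda>T. mean_upto T P) \<longlongrightarrow> c) at_top"
proof (induction rule: trig_poly.induct)
  case trig_poly_zero
  then show ?case by (auto simp: mean_upto_def)
next
  case (trig_poly_add_term Q c l)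
  then obtain d where d: "((\<lambda>T. mean_upto T Q) \<longlongrightarrow> d) at_top" by auto
  have "\<exists>b. ((\<lambda>T. mean_upto T (e l)) \<longlongrightarrow> b) at_top"
  proof (cases "l = 0")
    case True
    then have "e l = (\<lambda>t. 1)" by (auto simp: e_def)
    then have "\<forall>\<^sub>F T in at_top. mean_upto T (e l) = 1"
      by (intro eventually_mono[OF eventually_gt_at_top[of 0]]) (simp add: mean_upto_const)
    then show ?thesis by (intro exI[of _ 1] tendsto_eventually)
  qed (intro exI[of _ 0] mean_e_tendsto_0)
  then obtain b where b: "((\<lambda>T. mean_upto T (e l)) \<longlongrightarrow> b) at_top" ..
  have "((\<lambda>T. c * mean_upto T (e l) + mean_upto T Q) \<longlongrightarrow> c * b + d) at_top"
    by (rule tendsto_add[OF tendsto_mult_left[OF b] d])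
  moreover have "\<forall>\<^sub>F T in at_top. c * mean_upto T (e l) + mean_upto T Q = mean_upto T (\<lambda>t. c * e l t + Q t)"
    using eventually_gt_at_top[of 0]
  proof eventually_elim
    case (elim T)
    have "loc_int (\<lambda>t. c * e l t)"
      by (intro loc_int_mult_left L2_loc_loc_int L2_loc_bounded[where B=1]) simp_all
    from mean_upto_add[OF this L2_loc_loc_int[OF trig_poly_L2_loc[OF trig_poly_add_term.hyps]] elim]
    show ?case by (simp add: mean_upto_mult_left)
  qed
  ultimately show ?case by (intro exI) (rule Lim_transform_eventually)
qed

section \<open>Approximation by trigonometric polynomials\<close>

lemma trig_poly_continuous: "trig_poly P \<Longrightarrow> continuous_on S P"
proof (induction rule: trig_poly.induct)
  case (trig_poly_add_term Q c l)
  then show ?case unfolding e_def cis_conv_exp by (intro continuous_intros)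
qed auto

lemma trig_poly_sum: "trig_poly (\<lambda>t. \<Sum>k<n. c k * e (l k) t)" for n :: nat
  by (induction n) (auto simp: add.commute intro: trig_poly.intros)

lemma Bohr_uniform_approx:
  assumes "h \<in> Bohr" "\<epsilon> > 0"
  obtains Q where "trig_poly Q" "\<And>t. 0 \<le> t \<Longrightarrow> cmod (h t - Q t) \<le> \<epsilon>"
proof -
  from assms(1) obtain l c where
    "uniform_limit {0..} (\<lambda>n t. \<Sum>k<n. c k * e (l k) t) h sequentially"
    unfolding Bohr_def by auto
  from uniform_limitD[OF this assms(2)] obtain n where
    n: "\<forall>t\<in>{0..}. dist (\<Sum>k<n. c k * e (l k) t) (h t) < \<epsilon>"
    by (auto simp: eventually_sequentially)
  have "cmod (h t - (\<Sum>k<n. c k * e (l k) t)) \<le> \<epsilon>" if "0 \<le> t" for t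
    using n[rule_format, of t] that by (simp add: dist_norm norm_minus_commute)
  with trig_poly_sum show thesis by (rule that)
qed

lemma Bohr_measurable:
  assumes "h \<in> Bohr" shows "half_measurable h"
proof -
  from assms obtain l c where
    "uniform_limit {0..} (\<lambda>n t. \<Sum>k<n. c k * e (l k) t) h sequentially"
    unfolding Bohr_def by auto
  then have "continuous_on {0..} h"
    by (rule uniform_limit_theorem[rotated]) (auto intro!: always_eventually trig_poly_continuous trig_poly_sum)
  then show ?thesis by (intro continuous_imp_measurable_on_sets_lebesgue) auto
qed

lemma Bohr_L2_loc:
  assumes "h \<in> Bohr" shows "h \<in> L2_loc"
proof -
  obtain Q where Q: "trig_poly Q" "\<And>t. 0 \<le> t \<Longrightarrow> cmod (h t - Q t) \<le> 1"
    using Bohr_uniform_approx[OF assms, of 1] by auto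
  have [measurable]: "half_measurable Q" "half_measurable h"
    using Q(1) assms by (auto intro: trig_poly_measurable Bohr_measurable)
  have "(\<lambda>t. h t - Q t) \<in> L2_loc" using Q(2) by (intro L2_loc_bounded) auto
  from L2_loc_add[OF this trig_poly_L2_loc[OF Q(1)]] show ?thesis by simp
qed

lemma B2_L2_loc: "f \<in> B2 \<Longrightarrow> f \<in> L2_loc"
  by (simp add: B2_def)

lemma loc_int_sq_diff: "f \<in> L2_loc \<Longrightarrow> g \<in> L2_loc \<Longrightarrow> loc_int (\<lambda>t. (cmod (f t - g t))\<^sup>2)"
  by (rule L2_loc_loc_int_sq[OF L2_loc_diff])

lemma mean_sq_triangle:
  assumes "f \<in> L2_loc" "g \<in> L2_loc" "h \<in> L2_loc" "T > 0"
  shows "mean_sq T (\<lambda>t. f t - h t) \<le> 2 * mean_sq T (\<lambda>t. f t - g t) + 2 * mean_sq T (\<lambda>t. g t - h t)"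
proof -
  have "mean_sq T (\<lambda>t. f t - h t)
      \<le> mean_upto T (\<lambda>t. 2 * (cmod (f t - g t))\<^sup>2 + 2 * (cmod (g t - h t))\<^sup>2)"
    by (intro mean_upto_mono loc_int_add loc_int_mult_left loc_int_sq_diff assms cmod_diff_sq_le)
  also have "\<dots> = 2 * mean_sq T (\<lambda>t. f t - g t) + 2 * mean_sq T (\<lambda>t. g t - h t)"
    using assms by (simp add: mean_upto_add mean_upto_mult_left loc_int_mult_left loc_int_sq_diff)
  finally show ?thesis .
qed

lemma mean_sq_le_sup:
  assumes "f \<in> L2_loc" "\<And>t. 0 \<le> t \<Longrightarrow> cmod (f t) \<le> B" "T > 0"
  shows "mean_sq T f \<le> B\<^sup>2"
proof -
  have "mean_sq T f \<le> mean_upto T (\<lambda>t. B\<^sup>2)"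
    using power_mono[OF assms(2), of _ 2]
    by (intro mean_upto_mono loc_int_const L2_loc_loc_int_sq assms) auto
  then show ?thesis using mean_upto_const[OF assms(3), of "B\<^sup>2"] by simp
qed

text \<open>
  Definition of \<open>B2\<close>, with the approximating Bohr function replaced by a partial sum of its series;
  the losses are the factors 2 from \<open>mean_sq_triangle\<close>.
\<close>
lemma B2_trig_approx:
  assumes "f \<in> B2" "\<epsilon> > 0"
  obtains Q where "trig_poly Q" "\<forall>\<^sub>F T in at_top. mean_sq T (\<lambda>t. f t - Q t) < \<epsilon>"
proof -
  from assms obtain h where h: "h \<in> Bohr"
    and lim: "Limsup at_top (\<lambda>T. ereal (mean_sq T (\<lambda>t. f t - h t))) < ereal (\<epsilon> / 4)"
    unfolding B2_def by (auto dest!: spec[of _ "\<epsilon> / 4"])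
  obtain Q where Q: "trig_poly Q" "\<And>t. 0 \<le> t \<Longrightarrow> cmod (h t - Q t) \<le> sqrt (\<epsilon> / 4)"
    using Bohr_uniform_approx[OF h, of "sqrt (\<epsilon> / 4)"] assms(2) by auto
  have L2: "f \<in> L2_loc" "h \<in> L2_loc" "Q \<in> L2_loc"
    using assms(1) h Q(1) by (auto intro: B2_L2_loc Bohr_L2_loc trig_poly_L2_loc)
  have "\<forall>\<^sub>F T in at_top. ereal (mean_sq T (\<lambda>t. f t - h t)) < ereal (\<epsilon> / 4)"
    using lim by (rule Limsup_lessD)
  then have "\<forall>\<^sub>F T in at_top. mean_sq T (\<lambda>t. f t - Q t) < \<epsilon>"
    using eventually_gt_at_top[of 0]
  proof eventually_elim
    case (elim T)
    have "mean_sq T (\<lambda>t. h t - Q t) \<le> (sqrt (\<epsilon> / 4))\<^sup>2"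
      using Q(2) elim(2) by (intro mean_sq_le_sup L2_loc_diff L2)
    with mean_sq_triangle[OF L2(1,2,3) elim(2)] elim(1) assms(2) show ?case by simp
  qed
  with Q(1) show thesis by (rule that)
qed

text \<open>
  \<open>\<bar>Q\<bar>\<^sup>2 = Q * cnj Q\<close> is again a trigonometric polynomial.
\<close>
lemma trig_poly_mean_sq:
  assumes "trig_poly Q" shows "\<exists>c. ((\<lambda>T. mean_sq T Q) \<longlongrightarrow> c) at_top"
proof -
  obtain c where "((\<lambda>T. mean_upto T (\<lambda>t. Q t * cnj (Q t))) \<longlongrightarrow> c) at_top"
    using trig_poly_mean[OF trig_poly_mult[OF assms trig_poly_cnj[OF assms]]] by auto
  then have "((\<lambda>T. Re (mean_upto T (\<lambda>t. complex_of_real ((cmod (Q t))\<^sup>2)))) \<longlongrightarrow> Re c) at_top"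
    by (intro tendsto_Re) (simp only: complex_norm_square)
  then show ?thesis unfolding mean_upto_of_real by auto
qed

lemma B2_mean_sq_bounded:
  assumes "f \<in> B2" obtains C where "C \<ge> 0" "\<forall>\<^sub>F T in at_top. mean_sq T f \<le> C"
proof -
  obtain Q where Q: "trig_poly Q" "\<forall>\<^sub>F T in at_top. mean_sq T (\<lambda>t. f t - Q t) < 1"
    using B2_trig_approx[OF assms, of 1] by auto
  obtain B where B: "B \<ge> 0" "\<And>t. cmod (Q t) \<le> B" using trig_poly_bounded[OF Q(1)] by auto
  have L2: "f \<in> L2_loc" "Q \<in> L2_loc" using assms Q(1) by (auto intro: B2_L2_loc trig_poly_L2_loc)
  have "\<forall>\<^sub>F T in at_top. mean_sq T f \<le> 2 + 2 * B\<^sup>2"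
    using Q(2) eventually_gt_at_top[of 0]
  proof eventually_elim
    case (elim T)
    have "(\<lambda>t. 0) \<in> L2_loc" by (rule L2_loc_bounded) auto
    from mean_sq_triangle[OF L2 this elim(2)] mean_sq_le_sup[OF L2(2) B(2) elim(2)] elim(1)
    show ?case by simp
  qed
  then show thesis using that[of "2 + 2 * B\<^sup>2"] by simp
qed

section \<open>Functions orthogonal to all frequencies\<close>

text \<open>
  The members that lie in \<open>L2_loc\<close> are the representatives of 0 in \<open>A2\<close>.
\<close>
definition orthogonal_e :: "(real \<Rightarrow> complex) \<Rightarrow> bool" where
  "orthogonal_e \<phi> \<longleftrightarrow> (\<forall>l. has_binner \<phi> (e l) 0)"

lemma loc_int_mult_trig:
  fixes \<phi> :: "real \<Rightarrow> complex"
  assumes "half_measurable \<phi>" "loc_int \<phi>" "trig_poly Q"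
  shows "loc_int (\<lambda>t. \<phi> t * Q t)"
proof -
  obtain B where B: "B \<ge> 0" "\<And>t. cmod (Q t) \<le> B" using trig_poly_bounded[OF assms(3)] by auto
  have [measurable]: "half_measurable \<phi>" "half_measurable Q"
    using assms trig_poly_measurable by auto
  have "norm (\<phi> t * Q t) \<le> B * norm (\<phi> t)" for t
    using mult_left_mono[OF B(2)[of t], of "norm (\<phi> t)"] by (simp add: norm_mult mult.commute)
  then show ?thesis
    using loc_int_bound[OF _ loc_int_mult_left[OF loc_int_norm[OF assms(2)], of B], of "\<lambda>t. \<phi> t * Q t"]
    by simp
qed

lemma orthogonal_e_trig_poly:
  assumes "orthogonal_e \<phi>" "half_measurable \<phi>" "loc_int \<phi>" "trig_poly Q"
  shows "((\<lambda>T. mean_upto T (\<lambda>t. \<phi> t * Q t)) \<longlongrightarrow> 0) at_top"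
  using assms(4)
proof (induction rule: trig_poly.induct)
  case trig_poly_zero
  then show ?case by (simp add: mean_upto_def)
next
  case (trig_poly_add_term Q c l)
  have e: "trig_poly (e l)" for l using trig_poly.trig_poly_add_term[OF trig_poly.trig_poly_zero, of 1 l] by simp
  have "((\<lambda>T. mean_upto T (\<lambda>t. \<phi> t * e l t)) \<longlongrightarrow> 0) at_top"
    using assms(1)[unfolded orthogonal_e_def, rule_format, of "- l"] by (simp add: has_binner_def cnj_e)
  note tendsto_add[OF tendsto_mult_left[OF this, of c] trig_poly_add_term.IH]
  then have "((\<lambda>T. c * mean_upto T (\<lambda>t. \<phi> t * e l t) + mean_upto T (\<lambda>t. \<phi> t * Q t)) \<longlongrightarrow> c * 0 + 0) at_top"
    .
  moreover have "\<forall>\<^sub>F T in at_top. c * mean_upto T (\<lambda>t. \<phi> t * e l t) + mean_upto T (\<lambda>t. \<phi> t * Q t)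
      = mean_upto T (\<lambda>t. \<phi> t * (c * e l t + Q t))"
    using eventually_gt_at_top[of 0]
  proof eventually_elim
    case (elim T)
    have "mean_upto T (\<lambda>t. \<phi> t * (c * e l t + Q t)) = mean_upto T (\<lambda>t. c * (\<phi> t * e l t) + \<phi> t * Q t)"
      by (intro mean_upto_cong) (simp add: algebra_simps)
    also have "\<dots> = c * mean_upto T (\<lambda>t. \<phi> t * e l t) + mean_upto T (\<lambda>t. \<phi> t * Q t)"
      using elim assms(2,3) e trig_poly_add_term.hyps
      by (simp add: mean_upto_add mean_upto_mult_left loc_int_mult_left loc_int_mult_trig)
    finally show ?case by simp
  qed
  ultimately show ?case by (simp add: Lim_transform_eventually)
qed

lemma mult_le_weighted_squares:
  fixes a b \<eta> :: real assumes "\<eta> > 0" shows "a * b \<le> \<eta> * a\<^sup>2 + b\<^sup>2 / \<eta>"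
proof -
  have "0 \<le> ((\<eta> * a - b)\<^sup>2 + \<eta>\<^sup>2 * a\<^sup>2 + b\<^sup>2) / (2 * \<eta>)" using assms by simp
  also have "\<dots> = \<eta> * a\<^sup>2 + b\<^sup>2 / \<eta> - a * b"
    using assms by (simp add: field_simps power2_eq_square)
  finally show ?thesis by simp
qed

text \<open>
  Orthogonality to the exponentials passes to trigonometric polynomials \<open>Q\<close> by linearity, and from
  \<open>Q\<close> to a nearby \<open>g\<close> by Cauchy-Schwarz, here in the form of \<open>mult_le_weighted_squares\<close>. The second
  step is where the mean square of \<open>\<phi>\<close> has to be bounded: a general \<open>\<phi>\<close> that is orthogonal to all
  \<open>e l\<close> may carry unbounded mass on a sparse set.
\<close>
lemma orthogonal_e_B2:
  assumes "orthogonal_e \<phi>" "\<phi> \<in> L2_loc" "\<forall>\<^sub>F T in at_top. mean_sq T \<phi> \<le> C" "g \<in> B2"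
  shows "((\<lambda>T. mean_upto T (\<lambda>t. \<phi> t * cnj (g t))) \<longlongrightarrow> 0) at_top"
proof (rule tendstoI)
  fix \<epsilon> :: real assume "\<epsilon> > 0"
  (* In the weighted inequality the weight eta makes the term with phi at most epsilon/4; the
     approximation error of Q is then chosen small even after division by eta. *)
  define \<eta> where "\<eta> = \<epsilon> / (4 * (\<bar>C\<bar> + 1))"
  have "\<eta> > 0" using \<open>\<epsilon> > 0\<close> by (simp add: \<eta>_def add_nonneg_pos)
  have \<eta>C: "\<eta> * C \<le> \<epsilon> / 4"
  proof -
    have "\<eta> * C \<le> \<eta> * (\<bar>C\<bar> + 1)" using \<open>\<eta> > 0\<close> by (intro mult_left_mono) auto
    also have "\<dots> = \<epsilon> / 4" unfolding \<eta>_def by (simp add: field_simps)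
    finally show ?thesis .
  qed
  obtain Q where Q: "trig_poly Q" "\<forall>\<^sub>F T in at_top. mean_sq T (\<lambda>t. g t - Q t) < \<eta> * \<epsilon> / 4"
    using B2_trig_approx[OF assms(4), of "\<eta> * \<epsilon> / 4"] \<open>\<eta> > 0\<close> \<open>\<epsilon> > 0\<close> by auto
  note L2 = assms(2) B2_L2_loc[OF assms(4)] trig_poly_L2_loc[OF Q(1)]
  have "\<forall>\<^sub>F T in at_top. norm (mean_upto T (\<lambda>t. \<phi> t * cnj (Q t))) < \<epsilon> / 4"
    using orthogonal_e_trig_poly[OF assms(1) L2_loc_measurable L2_loc_loc_int trig_poly_cnj[OF Q(1)], OF assms(2,2)]
      \<open>\<epsilon> > 0\<close> by (auto simp: tendsto_iff dest!: spec[of _ "\<epsilon> / 4"])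
  then show "\<forall>\<^sub>F T in at_top. dist (mean_upto T (\<lambda>t. \<phi> t * cnj (g t))) 0 < \<epsilon>"
    using Q(2) assms(3) eventually_gt_at_top[of 0]
  proof eventually_elim
    case (elim T)
    let ?d = "\<lambda>t. g t - Q t"
    have "norm (mean_upto T (\<lambda>t. \<phi> t * cnj (?d t)))
        \<le> mean_upto T (\<lambda>t. \<eta> * (cmod (\<phi> t))\<^sup>2 + (1 / \<eta>) * (cmod (?d t))\<^sup>2)"
    proof (rule norm_mean_upto_le_mean)
      show "half_measurable (\<lambda>t. \<phi> t * cnj (?d t))"
        using L2_loc_measurable[OF L2_loc_cnj[OF L2_loc_diff[OF L2(2,3)]]] L2_loc_measurable[OF L2(1)]
        by (rule borel_measurable_times[rotated])
      show "loc_int (\<lambda>t. \<eta> * (cmod (\<phi> t))\<^sup>2 + (1 / \<eta>) * (cmod (?d t))\<^sup>2)"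
        by (intro loc_int_add loc_int_mult_left L2_loc_loc_int_sq L2_loc_diff L2)
      show "norm (\<phi> t * cnj (?d t)) \<le> \<eta> * (cmod (\<phi> t))\<^sup>2 + (1 / \<eta>) * (cmod (?d t))\<^sup>2" for t
        using mult_le_weighted_squares[OF \<open>\<eta> > 0\<close>, of "cmod (\<phi> t)" "cmod (?d t)"]
        by (simp add: norm_mult flip: complex_cnj_diff)
    qed (rule elim)
    also have "\<dots> = \<eta> * mean_sq T \<phi> + (1 / \<eta>) * mean_sq T ?d"
      unfolding mean_upto_mult_left[symmetric]
      by (intro mean_upto_add loc_int_mult_left L2_loc_loc_int_sq L2_loc_diff L2 elim)
    also have "\<dots> \<le> \<eta> * C + (1 / \<eta>) * (\<eta> * \<epsilon> / 4)"
      using elim \<open>\<eta> > 0\<close> by (intro add_mono mult_left_mono) auto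
    also have "\<dots> \<le> \<epsilon> / 4 + \<epsilon> / 4" using \<eta>C \<open>\<eta> > 0\<close> by simp
    finally have *: "norm (mean_upto T (\<lambda>t. \<phi> t * cnj (?d t))) \<le> \<epsilon> / 2" by simp
    have "mean_upto T (\<lambda>t. \<phi> t * cnj (g t)) = mean_upto T (\<lambda>t. \<phi> t * cnj (?d t) + \<phi> t * cnj (Q t))"
      by (intro mean_upto_cong) (simp add: algebra_simps)
    also have "\<dots> = mean_upto T (\<lambda>t. \<phi> t * cnj (?d t)) + mean_upto T (\<lambda>t. \<phi> t * cnj (Q t))"
      by (intro mean_upto_add L2_loc_loc_int_mult L2_loc_cnj L2_loc_diff L2 elim)
    finally have "norm (mean_upto T (\<lambda>t. \<phi> t * cnj (g t))) \<le>
      norm (mean_upto T (\<lambda>t. \<phi> t * cnj (?d t))) + norm (mean_upto T (\<lambda>t. \<phi> t * cnj (Q t)))"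
      by (simp only: norm_triangle_ineq)
    with * elim(1) \<open>\<epsilon> > 0\<close> show ?case by simp
  qed
qed

lemma mean_sq_diff_bounded:
  assumes "f \<in> L2_loc" "g \<in> L2_loc" "\<forall>\<^sub>F T in at_top. mean_sq T f \<le> C" "\<forall>\<^sub>F T in at_top. mean_sq T g \<le> D"
  shows "\<forall>\<^sub>F T in at_top. mean_sq T (\<lambda>t. f t - g t) \<le> 2 * C + 2 * D"
  using assms(3,4) eventually_gt_at_top[of 0]
proof eventually_elim
  case (elim T)
  have "(\<lambda>t. 0) \<in> L2_loc" by (rule L2_loc_bounded) auto
  from mean_sq_triangle[OF assms(1) this assms(2) elim(3)] elim(1,2) show ?case by simp
qed

lemma orthogonal_e_diff:
  assumes "half_measurable f" "loc_int f" "half_measurable g" "loc_int g"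
    and "\<forall>l. \<exists>c. has_binner f (e l) c \<and> has_binner g (e l) c"
  shows "orthogonal_e (\<lambda>t. f t - g t)"
  unfolding orthogonal_e_def has_binner_def
proof
  fix l
  obtain c where c: "has_binner f (e l) c" "has_binner g (e l) c" using assms(5) by auto
  have e: "trig_poly (\<lambda>t. cnj (e l t))"
    using trig_poly_cnj[OF trig_poly_add_term[OF trig_poly_zero, of 1 l]] by simp
  have "((\<lambda>T. mean_upto T (\<lambda>t. f t * cnj (e l t)) - mean_upto T (\<lambda>t. g t * cnj (e l t))) \<longlongrightarrow> 0) at_top"
    using tendsto_diff[OF c[unfolded has_binner_def]] by simp
  moreover have "\<forall>\<^sub>F T in at_top. mean_upto T (\<lambda>t. f t * cnj (e l t)) - mean_upto T (\<lambda>t. g t * cnj (e l t))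
      = mean_upto T (\<lambda>t. (f t - g t) * cnj (e l t))"
    using eventually_gt_at_top[of 0]
  proof eventually_elim
    case (elim T)
    show ?case unfolding left_diff_distrib
      by (rule mean_upto_diff[symmetric, OF _ _ elim]) (intro loc_int_mult_trig assms e)+
  qed
  ultimately show "((\<lambda>T. mean_upto T (\<lambda>t. (f t - g t) * cnj (e l t))) \<longlongrightarrow> 0) at_top"
    by (rule Lim_transform_eventually)
qed

lemma loc_int_Re: "loc_int f \<Longrightarrow> loc_int (\<lambda>t. Re (f t))"
  by (auto simp: loc_int_def)

lemma mean_upto_Re:
  assumes "loc_int f" "T > 0" shows "mean_upto T (\<lambda>t. Re (f t)) = Re (mean_upto T f)"
  using assms by (simp add: mean_upto_def loc_int_def)

text \<open>
  An element of \<open>B2\<close> is determined by its coefficients: with \<open>\<phi> = u - v\<close>, the mean of \<open>\<bar>\<phi>\<bar>\<^sup>2\<close> is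
  \<open>\<langle>\<phi>, u\<rangle> - \<langle>\<phi>, v\<rangle>\<close>, and both inner products vanish.
\<close>
lemma B2_mean_sq_diff_unique:
  assumes "u \<in> B2" "v \<in> B2" "orthogonal_e (\<lambda>t. u t - v t)"
  shows "((\<lambda>T. mean_sq T (\<lambda>t. u t - v t)) \<longlongrightarrow> 0) at_top"
proof -
  let ?\<phi> = "\<lambda>t. u t - v t"
  note L2 = B2_L2_loc[OF assms(1)] B2_L2_loc[OF assms(2)]
  note L2d = L2_loc_diff[OF L2]
  obtain C where C: "\<forall>\<^sub>F T in at_top. mean_sq T u \<le> C" using B2_mean_sq_bounded[OF assms(1)] .
  obtain D where D: "\<forall>\<^sub>F T in at_top. mean_sq T v \<le> D" using B2_mean_sq_bounded[OF assms(2)] .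
  note * = orthogonal_e_B2[OF assms(3) L2d mean_sq_diff_bounded[OF L2 C D]]
  have "((\<lambda>T. Re (mean_upto T (\<lambda>t. ?\<phi> t * cnj (u t)) - mean_upto T (\<lambda>t. ?\<phi> t * cnj (v t)))) \<longlongrightarrow> 0) at_top"
    using tendsto_Re[OF tendsto_diff[OF *[OF assms(1)] *[OF assms(2)]]] by simp
  moreover have "\<forall>\<^sub>F T in at_top. Re (mean_upto T (\<lambda>t. ?\<phi> t * cnj (u t)) - mean_upto T (\<lambda>t. ?\<phi> t * cnj (v t)))
      = mean_sq T ?\<phi>"
    using eventually_gt_at_top[of 0]
  proof eventually_elim
    case (elim T)
    have "mean_upto T (\<lambda>t. ?\<phi> t * cnj (u t)) - mean_upto T (\<lambda>t. ?\<phi> t * cnj (v t))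
        = mean_upto T (\<lambda>t. ?\<phi> t * cnj (u t) - ?\<phi> t * cnj (v t))"
      by (rule mean_upto_diff[symmetric, OF _ _ elim]) (intro L2_loc_loc_int_mult L2_loc_cnj L2 L2d)+
    also have "\<dots> = mean_upto T (\<lambda>t. complex_of_real ((cmod (?\<phi> t))\<^sup>2))"
      unfolding complex_norm_square by (intro mean_upto_cong) (simp add: algebra_simps)
    finally show ?case by (simp only: mean_upto_of_real Re_complex_of_real)
  qed
  ultimately show ?thesis by (rule Lim_transform_eventually)
qed

lemma B2_if_mean_sq_diff_tendsto_0:
  assumes "g \<in> B2" "f \<in> L2_loc" "((\<lambda>T. mean_sq T (\<lambda>t. f t - g t)) \<longlongrightarrow> 0) at_top"
  shows "f \<in> B2"
  unfolding B2_def
proof (intro CollectI conjI allI impI assms(2))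
  fix \<epsilon> :: real assume "\<epsilon> > 0"
  with assms(1) obtain h where h: "h \<in> Bohr"
    and lim: "Limsup at_top (\<lambda>T. ereal (mean_sq T (\<lambda>t. g t - h t))) < ereal (\<epsilon> / 8)"
    unfolding B2_def by (auto dest!: spec[of _ "\<epsilon> / 8"])
  have "0 < \<epsilon> / 8" using \<open>\<epsilon> > 0\<close> by simp
  have "\<forall>\<^sub>F T in at_top. ereal (mean_sq T (\<lambda>t. f t - h t)) \<le> ereal (\<epsilon> / 2)"
    using Limsup_lessD[OF lim] order_tendstoD(2)[OF assms(3) \<open>0 < \<epsilon> / 8\<close>] eventually_gt_at_top[of 0]
  proof eventually_elim
    case (elim T)
    with mean_sq_triangle[OF assms(2) B2_L2_loc[OF assms(1)] Bohr_L2_loc[OF h], of T]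
    show ?case by simp
  qed
  then have "Limsup at_top (\<lambda>T. ereal (mean_sq T (\<lambda>t. f t - h t))) \<le> ereal (\<epsilon> / 2)"
    by (rule Limsup_bounded)
  also have "\<dots> < ereal \<epsilon>" using \<open>\<epsilon> > 0\<close> by simp
  finally show "\<exists>h\<in>Bohr. Limsup at_top (\<lambda>T. ereal (mean_sq T (\<lambda>t. f t - h t))) < ereal \<epsilon>"
    using h by (rule_tac bexI)
qed

text \<open>
  The criterion to which both parts are reduced. If \<open>\<phi> = f - g\<close> is orthogonal to all frequencies
  and no mean square is lost, then \<open>\<langle>\<phi>, g\<rangle> = 0\<close> and \<open>\<parallel>\<phi>\<parallel>\<^sup>2 = \<parallel>f\<parallel>\<^sup>2 - \<parallel>g\<parallel>\<^sup>2 - 2 Re \<langle>\<phi>, g\<rangle> = 0\<close>.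
\<close>
lemma B2_if_same_mean_sq:
  assumes "g \<in> B2" "f \<in> L2_loc" "orthogonal_e (\<lambda>t. f t - g t)"
    and "((\<lambda>T. mean_sq T f - mean_sq T g) \<longlongrightarrow> 0) at_top"
  shows "f \<in> B2"
proof (rule B2_if_mean_sq_diff_tendsto_0[OF assms(1,2)])
  let ?\<phi> = "\<lambda>t. f t - g t"
  note L2 = assms(2) B2_L2_loc[OF assms(1)]
  note L2d = L2_loc_diff[OF L2]
  obtain C where C: "\<forall>\<^sub>F T in at_top. mean_sq T g \<le> C" using B2_mean_sq_bounded[OF assms(1)] .
  have Cf: "\<forall>\<^sub>F T in at_top. mean_sq T f \<le> C + 1"
    using C order_tendstoD(2)[OF assms(4) zero_less_one] by eventually_elim simp
  have "((\<lambda>T. mean_upto T (\<lambda>t. ?\<phi> t * cnj (g t))) \<longlongrightarrow> 0) at_top"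
    by (rule orthogonal_e_B2[OF assms(3) L2d mean_sq_diff_bounded[OF L2 Cf C] assms(1)])
  from tendsto_diff[OF assms(4) tendsto_mult_left[OF tendsto_Re[OF this], of 2]]
  have "((\<lambda>T. mean_sq T f - mean_sq T g - 2 * Re (mean_upto T (\<lambda>t. ?\<phi> t * cnj (g t)))) \<longlongrightarrow> 0) at_top"
    by simp
  moreover have "\<forall>\<^sub>F T in at_top. mean_sq T f - mean_sq T g - 2 * Re (mean_upto T (\<lambda>t. ?\<phi> t * cnj (g t)))
      = mean_sq T ?\<phi>"
    using eventually_gt_at_top[of 0]
  proof eventually_elim
    case (elim T)
    have l: "loc_int (\<lambda>t. ?\<phi> t * cnj (g t))" by (intro L2_loc_loc_int_mult L2_loc_cnj L2 L2d)
    have lre: "loc_int (\<lambda>t. Re (?\<phi> t * cnj (g t)))" by (rule loc_int_Re[OF l])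
    have "mean_sq T ?\<phi> = mean_upto T (\<lambda>t. (cmod (f t))\<^sup>2 - (cmod (g t))\<^sup>2 - 2 * Re (?\<phi> t * cnj (g t)))"
      unfolding cmod_power2 by (intro mean_upto_cong) (simp add: algebra_simps power2_eq_square)
    also have "\<dots> = mean_sq T f - mean_sq T g - 2 * mean_upto T (\<lambda>t. Re (?\<phi> t * cnj (g t)))"
      using elim by (simp only: mean_upto_diff loc_int_diff loc_int_mult_left lre L2_loc_loc_int_sq[OF L2(1)]
        L2_loc_loc_int_sq[OF L2(2)] mean_upto_mult_left)
    finally show ?case by (simp only: mean_upto_Re[OF l elim])
  qed
  ultimately show "((\<lambda>T. mean_sq T ?\<phi>) \<longlongrightarrow> 0) at_top" by (rule Lim_transform_eventually)
qed

section \<open>Uniform integrability in \<open>B2\<close>\<close>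

lemma mean_norm_le_mean_sq:
  assumes "\<phi> \<in> L2_loc" "\<kappa> > 0" "T > 0"
  shows "mean_upto T (\<lambda>t. cmod (\<phi> t)) \<le> \<kappa> + mean_sq T \<phi> / \<kappa>"
proof -
  have "mean_upto T (\<lambda>t. cmod (\<phi> t)) \<le> mean_upto T (\<lambda>t. \<kappa> + (1 / \<kappa>) * (cmod (\<phi> t))\<^sup>2)"
    using mult_le_weighted_squares[OF assms(2), of 1]
    by (intro mean_upto_mono loc_int_add loc_int_const loc_int_mult_left L2_loc_loc_int_sq loc_int_norm
        L2_loc_loc_int assms) simp
  also have "\<dots> = \<kappa> + (1 / \<kappa>) * mean_sq T \<phi>"
    unfolding mean_upto_mult_left[symmetric]
    by (subst mean_upto_add) (intro loc_int_const loc_int_mult_left L2_loc_loc_int_sq assms | simp add: mean_upto_const assms(3))+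
  finally show ?thesis by simp
qed

lemma mean_norm_tendsto_0:
  assumes "\<phi> \<in> L2_loc" "((\<lambda>T. mean_sq T \<phi>) \<longlongrightarrow> 0) at_top"
  shows "((\<lambda>T. mean_upto T (\<lambda>t. cmod (\<phi> t))) \<longlongrightarrow> 0) at_top"
proof (rule tendstoI)
  fix r :: real assume "r > 0"
  then have "0 < r / 4 * (r / 4)" by simp
  from order_tendstoD(2)[OF assms(2) this]
  show "\<forall>\<^sub>F T in at_top. dist (mean_upto T (\<lambda>t. cmod (\<phi> t))) 0 < r"
    using eventually_gt_at_top[of 0]
  proof eventually_elim
    case (elim T)
    have "mean_upto T (\<lambda>t. cmod (\<phi> t)) \<le> r / 4 + mean_sq T \<phi> / (r / 4)"
      using \<open>r > 0\<close> elim(2) by (intro mean_norm_le_mean_sq assms(1)) auto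
    also have "mean_sq T \<phi> / (r / 4) \<le> r / 4"
      using elim(1) \<open>r > 0\<close> by (subst pos_divide_le_eq) auto
    finally have "mean_upto T (\<lambda>t. cmod (\<phi> t)) < r" using \<open>r > 0\<close> by simp
    moreover have "0 \<le> mean_upto T (\<lambda>t. cmod (\<phi> t))" using elim(2) by (intro mean_upto_nonneg) auto
    ultimately show ?case by simp
  qed
qed

lemma loc_int_sq_mult_weight:
  assumes "f \<in> L2_loc" "half_measurable w" "\<And>t. 0 \<le> t \<Longrightarrow> 0 \<le> w t \<and> w t \<le> (1 :: real)"
  shows "loc_int (\<lambda>t. (cmod (f t))\<^sup>2 * w t)"
proof (rule loc_int_bound[OF _ L2_loc_loc_int_sq[OF assms(1)]])
  have [measurable]: "half_measurable f" using assms(1) by (rule L2_loc_measurable)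
  note [measurable] = assms(2)
  show "half_measurable (\<lambda>t. (cmod (f t))\<^sup>2 * w t)" by simp
  show "norm ((cmod (f t))\<^sup>2 * w t) \<le> (cmod (f t))\<^sup>2" if "0 \<le> t" for t
    using assms(3)[OF that] mult_left_mono[of "w t" 1 "(cmod (f t))\<^sup>2"] by (simp add: abs_mult)
qed

lemma loc_int_weight:
  assumes "half_measurable w" "\<And>t. 0 \<le> t \<Longrightarrow> 0 \<le> w t \<and> w t \<le> (1 :: real)"
  shows "loc_int w"
  by (rule loc_int_bound[OF assms(1) loc_int_const[of 1]]) (use assms(2) in auto)

text \<open>
  Since \<open>g\<close> is close in mean square to a bounded function, \<open>\<bar>g\<bar>\<^sup>2\<close> cannot concentrate where the
  weight \<open>w\<close> is small in mean. Weights with values in \<open>[0, 1]\<close> are used in place of sets so that the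
  statement applies both to indicators and to moduli of differences. The quantifier over \<open>w\<close> stands
  inside \<open>eventually\<close> because the threshold for \<open>T\<close> comes from the approximation of \<open>g\<close> alone.
\<close>
lemma B2_uniformly_integrable:
  assumes "g \<in> B2" "\<epsilon> > 0"
  obtains B where "B \<ge> 0"
    "\<forall>\<^sub>F T in at_top. \<forall>w. half_measurable w \<longrightarrow> (\<forall>t\<ge>0. 0 \<le> w t \<and> w t \<le> 1) \<longrightarrow>
       mean_upto T (\<lambda>t. (cmod (g t))\<^sup>2 * w t) \<le> \<epsilon> + B * mean_upto T w"
proof -
  obtain Q where Q: "trig_poly Q" "\<forall>\<^sub>F T in at_top. mean_sq T (\<lambda>t. g t - Q t) < \<epsilon> / 2"
    using B2_trig_approx[OF assms(1), of "\<epsilon> / 2"] assms(2) by auto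
  obtain b where b: "b \<ge> 0" "\<And>t. cmod (Q t) \<le> b" using trig_poly_bounded[OF Q(1)] by auto
  note L2 = B2_L2_loc[OF assms(1)] trig_poly_L2_loc[OF Q(1)]
  have "\<forall>\<^sub>F T in at_top. \<forall>w. half_measurable w \<longrightarrow> (\<forall>t\<ge>0. 0 \<le> w t \<and> w t \<le> 1) \<longrightarrow>
       mean_upto T (\<lambda>t. (cmod (g t))\<^sup>2 * w t) \<le> \<epsilon> + (2 * b\<^sup>2) * mean_upto T w"
    using Q(2) eventually_gt_at_top[of 0]
  proof eventually_elim
    case (elim T)
    show ?case
    proof (intro allI impI)
      fix w :: "real \<Rightarrow> real" assume w: "half_measurable w" "\<forall>t\<ge>0. 0 \<le> w t \<and> w t \<le> 1"
      have l: "loc_int (\<lambda>t. 2 * (cmod (g t - Q t))\<^sup>2)" "loc_int (\<lambda>t. (2 * b\<^sup>2) * w t)"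
        by (intro loc_int_mult_left loc_int_sq_diff L2 loc_int_weight; use w in simp)+
      have "mean_upto T (\<lambda>t. (cmod (g t))\<^sup>2 * w t)
          \<le> mean_upto T (\<lambda>t. 2 * (cmod (g t - Q t))\<^sup>2 + (2 * b\<^sup>2) * w t)"
      proof (rule mean_upto_mono[OF loc_int_sq_mult_weight[OF L2(1) w(1)] loc_int_add[OF l] elim(2)])
        fix t :: real assume "0 \<le> t"
        then have wt: "0 \<le> w t" "w t \<le> 1" using w(2) by auto
        have "(cmod (g t))\<^sup>2 * w t \<le> (2 * (cmod (g t - Q t))\<^sup>2 + 2 * (cmod (Q t))\<^sup>2) * w t"
          using cmod_add_sq_le[of "g t - Q t" "Q t"] wt(1) by (intro mult_right_mono) auto
        also have "\<dots> = 2 * (cmod (g t - Q t))\<^sup>2 * w t + 2 * (cmod (Q t))\<^sup>2 * w t" by (simp add: distrib_right)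
        also have "\<dots> \<le> 2 * (cmod (g t - Q t))\<^sup>2 * 1 + 2 * b\<^sup>2 * w t"
          using wt b by (intro add_mono mult_mono mult_left_mono power_mono mult_right_mono) auto
        finally show "(cmod (g t))\<^sup>2 * w t \<le> 2 * (cmod (g t - Q t))\<^sup>2 + (2 * b\<^sup>2) * w t" by simp
      qed (use w(2) in auto)
      also have "\<dots> = 2 * mean_sq T (\<lambda>t. g t - Q t) + (2 * b\<^sup>2) * mean_upto T w"
        unfolding mean_upto_mult_left[symmetric] by (rule mean_upto_add[OF l elim(2)])
      also have "\<dots> \<le> \<epsilon> + (2 * b\<^sup>2) * mean_upto T w" using elim(1) by simp
      finally show "mean_upto T (\<lambda>t. (cmod (g t))\<^sup>2 * w t) \<le> \<epsilon> + (2 * b\<^sup>2) * mean_upto T w" .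
    qed
  qed
  then show thesis using that[of "2 * b\<^sup>2"] by simp
qed

text \<open>
  If the mean square is at least \<open>r\<close> for arbitrarily large \<open>T\<close>, then a close trigonometric polynomial
  \<open>Q\<close> has mean square at least \<open>r / 4\<close> for such \<open>T\<close>, hence in the limit, since its mean square
  converges. This bound is then passed back to \<open>f\<close>.
\<close>
lemma B2_mean_sq_bounded_below:
  assumes "f \<in> B2" "\<not> has_bnorm f 0"
  obtains c where "c > 0" "\<forall>\<^sub>F T in at_top. c \<le> mean_sq T f"
proof -
  have nlim: "\<not> ((\<lambda>T. mean_sq T f) \<longlongrightarrow> 0) at_top"
  proof
    assume "((\<lambda>T. mean_sq T f) \<longlongrightarrow> 0) at_top"
    with assms(2) show False by (simp add: has_bnorm_0_if_mean_sq_tendsto_0)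
  qed
  obtain r where r: "r > 0" "\<exists>\<^sub>F T in at_top. r \<le> mean_sq T f"
  proof (rule ccontr)
    assume "\<not> thesis"
    with that have "\<forall>\<^sub>F T in at_top. mean_sq T f < r" if "r > 0" for r
      using \<open>r > 0\<close> by (fastforce simp: frequently_def not_le)
    moreover have "\<forall>\<^sub>F T in at_top. 0 \<le> mean_sq T f"
      by (rule eventually_mono[OF eventually_gt_at_top[of 0]]) (intro mean_upto_nonneg; simp)
    ultimately have "((\<lambda>T. mean_sq T f) \<longlongrightarrow> 0) at_top"
      by (intro order_tendstoI) (auto elim: eventually_mono)
    with nlim show False ..
  qed
  obtain Q where Q: "trig_poly Q" "\<forall>\<^sub>F T in at_top. mean_sq T (\<lambda>t. f t - Q t) < r / 16"
    using B2_trig_approx[OF assms(1), of "r / 16"] r(1) by auto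
  obtain q where q: "((\<lambda>T. mean_sq T Q) \<longlongrightarrow> q) at_top" using trig_poly_mean_sq[OF Q(1)] by auto
  note L2 = B2_L2_loc[OF assms(1)] trig_poly_L2_loc[OF Q(1)]
  have L20: "(\<lambda>t. 0) \<in> L2_loc" by (rule L2_loc_bounded) auto
  have *: "mean_sq T f \<le> 2 * mean_sq T (\<lambda>t. f t - Q t) + 2 * mean_sq T Q"
    "mean_sq T Q \<le> 2 * mean_sq T (\<lambda>t. f t - Q t) + 2 * mean_sq T f" if "T > 0" for T
    using mean_sq_triangle[OF L2 L20 that] mean_sq_triangle[OF L2(2,1) L20 that]
    by (simp_all add: norm_minus_commute)
  have "q \<ge> r / 4"
  proof (rule ccontr)
    assume "\<not> r / 4 \<le> q"
    then have "\<forall>\<^sub>F T in at_top. mean_sq T Q < r / 4" by (intro order_tendstoD(2)[OF q]) simp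
    then have "\<forall>\<^sub>F T in at_top. \<not> r \<le> mean_sq T f" using Q(2) eventually_gt_at_top[of 0]
    proof eventually_elim
      case (elim T)
      with *(1)[of T] r(1) show ?case by simp
    qed
    with r(2) show False by (simp add: frequently_def)
  qed
  then have "\<forall>\<^sub>F T in at_top. r / 5 < mean_sq T Q" using r(1) by (intro order_tendstoD(1)[OF q]) simp
  then have "\<forall>\<^sub>F T in at_top. r / 100 \<le> mean_sq T f" using Q(2) eventually_gt_at_top[of 0]
  proof eventually_elim
    case (elim T)
    with *(2)[of T] r(1) show ?case by simp
  qed
  then show thesis using that[of "r / 100"] r(1) by simp
qed

section \<open>Functions not concentrated on null sets\<close>

lemma integral_lebesgue_on_eq_indicator:
  fixes h :: "real \<Rightarrow> real"
  assumes "A \<in> sets lebesgue"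
  shows "(LINT t|lebesgue_on A. h t) = (LINT t|lebesgue. indicator A t * h t)"
  using integral_restrict_space[of A lebesgue h] assms by simp

lemma integrable_lebesgue_on_iff:
  fixes h :: "real \<Rightarrow> real"
  assumes "A \<in> sets lebesgue"
  shows "integrable (lebesgue_on A) h \<longleftrightarrow> integrable lebesgue (\<lambda>t. indicator A t * h t)"
  using integrable_restrict_space[of A lebesgue h] assms by simp

lemma integrable_lebesgue_on_subset:
  fixes h :: "real \<Rightarrow> real"
  assumes "integrable (lebesgue_on B) h" "A \<in> sets lebesgue" "B \<in> sets lebesgue" "A \<subseteq> B"
  shows "integrable (lebesgue_on A) h"
proof -
  have "integrable lebesgue (\<lambda>t. indicator A t * (indicator B t * h t))"
    using integrable_real_mult_indicator[of A lebesgue "\<lambda>t. indicator B t * h t"] assms(1,2)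
    by (simp add: integrable_lebesgue_on_iff[OF assms(3)] mult.commute)
  also have "(\<lambda>t. indicator A t * (indicator B t * h t)) = (\<lambda>t. indicator A t * h t)"
    using assms(4) by (intro ext) (auto split: split_indicator)
  finally show ?thesis by (simp add: integrable_lebesgue_on_iff[OF assms(2)])
qed

lemma integral_lebesgue_on_mono:
  fixes h :: "real \<Rightarrow> real"
  assumes "integrable (lebesgue_on B) h" "A \<in> sets lebesgue" "B \<in> sets lebesgue" "A \<subseteq> B" "\<And>t. 0 \<le> h t"
  shows "(LINT t|lebesgue_on A. h t) \<le> (LINT t|lebesgue_on B. h t)"
  unfolding integral_lebesgue_on_eq_indicator[OF assms(2)] integral_lebesgue_on_eq_indicator[OF assms(3)]
proof (rule integral_mono)
  show "integrable lebesgue (\<lambda>t. indicator A t * h t)"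
    using integrable_lebesgue_on_subset[OF assms(1-4)] by (simp add: integrable_lebesgue_on_iff[OF assms(2)])
  show "integrable lebesgue (\<lambda>t. indicator B t * h t)"
    using assms(1) by (simp add: integrable_lebesgue_on_iff[OF assms(3)])
  show "indicator A t * h t \<le> indicator B t * h t" for t
    using assms(4,5) by (auto simp: indicator_def)
qed

lemma integral_lebesgue_on_Un_le:
  fixes h :: "real \<Rightarrow> real"
  assumes "integrable (lebesgue_on (A \<union> B)) h" "A \<in> sets lebesgue" "B \<in> sets lebesgue" "\<And>t. 0 \<le> h t"
  shows "(LINT t|lebesgue_on (A \<union> B). h t) \<le> (LINT t|lebesgue_on A. h t) + (LINT t|lebesgue_on B. h t)"
proof -
  have AB: "A \<union> B \<in> sets lebesgue" using assms by auto
  have i: "integrable lebesgue (\<lambda>t. indicator A t * h t)" "integrable lebesgue (\<lambda>t. indicator B t * h t)"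
    using integrable_lebesgue_on_subset[OF assms(1,2) AB] integrable_lebesgue_on_subset[OF assms(1,3) AB]
    by (auto simp: integrable_lebesgue_on_iff[OF assms(2)] integrable_lebesgue_on_iff[OF assms(3)])
  have "(LINT t|lebesgue. indicator (A \<union> B) t * h t) \<le> (LINT t|lebesgue. indicator A t * h t + indicator B t * h t)"
  proof (rule integral_mono)
    show "integrable lebesgue (\<lambda>t. indicator (A \<union> B) t * h t)"
      using assms(1) by (simp add: integrable_lebesgue_on_iff[OF AB])
    show "integrable lebesgue (\<lambda>t. indicator A t * h t + indicator B t * h t)"
      using i by (rule Bochner_Integration.integrable_add)
    show "indicator (A \<union> B) t * h t \<le> indicator A t * h t + indicator B t * h t" for t
      using assms(4)[of t] by (simp add: indicator_def)
  qed
  then show ?thesis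
    using i by (simp add: integral_lebesgue_on_eq_indicator assms AB)
qed

text \<open>
  Null sets have density exactly 0, whereas the approximation argument produces sets of small
  positive density. The gap is closed by a gliding hump: if sets \<open>S k\<close> of upper density at most
  \<open>1 / (k + 1)\<close> all carry a fraction \<open>\<epsilon>\<close> of the mass of \<open>\<bar>f\<bar>\<^sup>2\<close> at arbitrarily late times, then
  pasting \<open>S k\<close> into \<open>(\<tau> k, \<tau> (k + 1)]\<close>, for \<open>\<tau>\<close> growing fast enough, gives a null set that still
  carries the fraction \<open>\<epsilon> / 2\<close> at each time \<open>\<tau> (k + 1)\<close>. For this the mass up to \<open>\<tau> k\<close> must be
  negligible at time \<open>\<tau> (k + 1)\<close>, so the total mass has to be infinite; it is because \<open>\<parallel>f\<parallel> \<noteq> 0\<close>.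
\<close>
lemma not_CNS_uniform:
  assumes "f \<in> L2_loc" "not_CNS f" "\<not> has_bnorm f 0" "\<epsilon> > 0"
  obtains \<delta> where "\<delta> > 0"
    "\<And>S. S \<in> sets lebesgue \<Longrightarrow> S \<subseteq> {0..} \<Longrightarrow>
       \<forall>\<^sub>F T in at_top. measure lebesgue (S \<inter> {0..T}) \<le> \<delta> * T \<Longrightarrow>
       \<forall>\<^sub>F T in at_top. (LINT t|lebesgue_on (S \<inter> {0..T}). (cmod (f t))\<^sup>2)
         \<le> \<epsilon> * (LINT t|lebesgue_on {0..T}. (cmod (f t))\<^sup>2)"
proof (rule ccontr)
  define I where "I A = (LINT t|lebesgue_on A. (cmod (f t))\<^sup>2)" for A
  define F where "F T = I {0..T}" for T
  assume nothesis: "\<not> thesis"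
  have "\<exists>S. S \<in> sets lebesgue \<and> S \<subseteq> {0..} \<and> (\<forall>\<^sub>F T in at_top. measure lebesgue (S \<inter> {0..T}) \<le> T / real (Suc k)) \<and>
      (\<exists>\<^sub>F T in at_top. \<epsilon> * F T < I (S \<inter> {0..T}))" for k
  proof (rule ccontr)
    assume *: "\<nexists>S. S \<in> sets lebesgue \<and> S \<subseteq> {0..} \<and> (\<forall>\<^sub>F T in at_top. measure lebesgue (S \<inter> {0..T}) \<le> T / real (Suc k)) \<and>
      (\<exists>\<^sub>F T in at_top. \<epsilon> * F T < I (S \<inter> {0..T}))"
    have thesis
    proof (rule that[of "1 / real (Suc k)"])
      fix S :: "real set"
      assume "S \<in> sets lebesgue" "S \<subseteq> {0..}"
        "\<forall>\<^sub>F T in at_top. measure lebesgue (S \<inter> {0..T}) \<le> 1 / real (Suc k) * T"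
      with * show "\<forall>\<^sub>F T in at_top. (LINT t|lebesgue_on (S \<inter> {0..T}). (cmod (f t))\<^sup>2)
         \<le> \<epsilon> * (LINT t|lebesgue_on {0..T}. (cmod (f t))\<^sup>2)"
        by (simp add: frequently_def not_less I_def F_def)
    qed simp
    with nothesis show False ..
  qed
  from choice[OF allI[OF this]] obtain S where "\<forall>k. S k \<in> sets lebesgue \<and> S k \<subseteq> {0..} \<and>
      (\<forall>\<^sub>F T in at_top. measure lebesgue (S k \<inter> {0..T}) \<le> T / real (Suc k)) \<and>
      (\<exists>\<^sub>F T in at_top. \<epsilon> * F T < I (S k \<inter> {0..T}))" ..
  then have S: "\<And>k. S k \<in> sets lebesgue" "\<And>k. S k \<subseteq> {0..}"
    and S_small: "\<And>k. \<forall>\<^sub>F T in at_top. measure lebesgue (S k \<inter> {0..T}) \<le> T / real (Suc k)"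
    and S_large: "\<And>k. \<exists>\<^sub>F T in at_top. \<epsilon> * F T < I (S k \<inter> {0..T})"
    by simp_all
  have int: "integrable (lebesgue_on {0..T}) (\<lambda>t. (cmod (f t))\<^sup>2)" for T
  proof (rule integrable_lebesgue_on_subset)
    show "integrable (lebesgue_on {0..max T 1}) (\<lambda>t. (cmod (f t))\<^sup>2)"
      using L2_loc_loc_int_sq[OF assms(1)] by (simp add: loc_int_def)
  qed auto
  have I_mono: "I A \<le> I B" if "A \<subseteq> B" "B \<subseteq> {0..T}" "A \<in> sets lebesgue" "B \<in> sets lebesgue" for A B T
    unfolding I_def
    by (intro integral_lebesgue_on_mono integrable_lebesgue_on_subset[OF int[of T]] that) auto
  have I_Un: "I (A \<union> B) \<le> I A + I B" if "A \<union> B \<subseteq> {0..T}" "A \<in> sets lebesgue" "B \<in> sets lebesgue" for A B T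
    unfolding I_def
    by (intro integral_lebesgue_on_Un_le integrable_lebesgue_on_subset[OF int[of T]] that) (use that in auto)
  have F_mono: "F T \<le> F T'" if "T \<le> T'" for T T'
    unfolding F_def using that by (intro I_mono[of _ _ T']) auto
  have F_nonneg: "0 \<le> F T" for T unfolding F_def I_def by simp
  have F_unbounded: "\<forall>\<^sub>F T in at_top. K \<le> F T" for K
  proof -
    have "\<exists>T. K \<le> F T"
    proof (rule ccontr)
      assume "\<nexists>T. K \<le> F T"
      then have "F T \<le> K" for T by (meson linear)
      then have "\<forall>\<^sub>F T in at_top. norm (mean_sq T f) \<le> K / T"
        by (intro eventually_mono[OF eventually_gt_at_top[of 0]])
          (simp add: mean_upto_def F_def I_def divide_right_mono)
      moreover have "((\<lambda>T. K / T) \<longlongrightarrow> 0) at_top"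
        by (rule const_divide_tendsto_0)
      ultimately have "((\<lambda>T. mean_sq T f) \<longlongrightarrow> 0) at_top" by (rule Lim_null_comparison)
      with assms(3) show False by (simp add: has_bnorm_0_if_mean_sq_tendsto_0)
    qed
    then obtain T0 where "K \<le> F T0" ..
    then show ?thesis
      by (intro eventually_mono[OF eventually_ge_at_top[of T0]]) (meson F_mono order_trans)
  qed
  define P where "P n T \<longleftrightarrow> 1 \<le> T \<and> (\<forall>T'\<ge>T. measure lebesgue (S n \<inter> {0..T'}) \<le> T' / real (Suc n))" for n T
  define R where "R n T T' \<longleftrightarrow> real (Suc n) * T \<le> T' \<and> T + 1 \<le> T' \<and> F T \<le> \<epsilon> / 2 * F T' \<and>
    \<epsilon> * F T' < I (S n \<inter> {0..T'})" for n T T'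
  have P_ev: "\<forall>\<^sub>F T in at_top. P n T" for n
    unfolding P_def using S_small[of n]
    by (intro eventually_conj eventually_ge_at_top) (auto simp: eventually_at_top_linorder intro: order_trans)
  have "\<exists>\<tau>. \<forall>n. P n (\<tau> n) \<and> R n (\<tau> n) (\<tau> (Suc n))"
  proof (rule dependent_nat_choice)
    show "\<exists>T. P 0 T" using eventually_happens[OF P_ev] by simp
    fix T n
    have ev: "\<forall>\<^sub>F T' in at_top. P (Suc n) T' \<and> real (Suc n) * T \<le> T' \<and> T + 1 \<le> T' \<and> F T / (\<epsilon> / 2) \<le> F T'"
      by (intro eventually_conj eventually_ge_at_top P_ev F_unbounded)
    from frequently_ex[OF frequently_eventually_conj[OF S_large[of n] ev]]
    show "\<exists>T'. P (Suc n) T' \<and> R n T T'"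
      unfolding R_def using assms(4) by (auto simp: field_simps)
  qed
  then obtain \<tau> where \<tau>: "\<And>n. P n (\<tau> n)" "\<And>n. R n (\<tau> n) (\<tau> (Suc n))" by blast
  have \<tau>_ge1: "1 \<le> \<tau> n" and S_density: "\<And>T. \<tau> n \<le> T \<Longrightarrow> measure lebesgue (S n \<inter> {0..T}) \<le> T / real (Suc n)" for n
    using \<tau>(1)[of n] by (auto simp: P_def)
  have \<tau>_growth: "real (Suc n) * \<tau> n \<le> \<tau> (Suc n)" and \<tau>_step: "\<tau> n + 1 \<le> \<tau> (Suc n)"
    and F_step: "F (\<tau> n) \<le> \<epsilon> / 2 * F (\<tau> (Suc n))"
    and S_mass: "\<epsilon> * F (\<tau> (Suc n)) < I (S n \<inter> {0..\<tau> (Suc n)})" for n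
    using \<tau>(2)[of n] by (auto simp: R_def)
  have \<tau>_mono: "\<tau> m \<le> \<tau> n" if "m \<le> n" for m n
    by (rule lift_Suc_mono_le[OF _ that]) (use \<tau>_step in \<open>smt (verit)\<close>)
  have \<tau>_ge: "real n \<le> \<tau> n" for n
  proof (induction n)
    case (Suc n)
    then show ?case using \<tau>_step[of n] by simp
  qed (use \<tau>_ge1[of 0] in simp)
  define W where "W = (\<Union>k. S k \<inter> {\<tau> k<..\<tau> (Suc k)})"
  have W_sets: "W \<in> sets lebesgue" unfolding W_def
    by (rule sets.countable_UN) (auto intro!: sets.Int S(1))
  have W_sub: "W \<subseteq> {0..}" unfolding W_def using S(2) by auto
  have W_density: "measure lebesgue (W \<inter> {0..T}) / T \<le> 3 / real (Suc n)" if "\<tau> (Suc n) < T" for n T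
  proof -
    define k where "k = (LEAST k. T \<le> \<tau> (Suc k))"
    have "T \<le> \<tau> (Suc (nat \<lceil>T\<rceil>))" using \<tau>_ge[of "Suc (nat \<lceil>T\<rceil>)"] by linarith
    then have k: "T \<le> \<tau> (Suc k)" unfolding k_def by (rule LeastI)
    have "Suc n \<le> k"
    proof (rule ccontr)
      assume "\<not> Suc n \<le> k"
      with \<tau>_mono[of "Suc k" "Suc n"] k that show False by simp
    qed
    then obtain m where m: "k = Suc m" "n \<le> m" by (cases k) auto
    have "\<not> T \<le> \<tau> (Suc m)" using not_less_Least[of m "\<lambda>k. T \<le> \<tau> (Suc k)"] m(1) by (simp add: k_def)
    then have km: "\<tau> (Suc m) < T" by simp
    have T0: "0 < T" using km \<tau>_ge1[of "Suc m"] by simp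
    (* Up to time T only the last two pieces of W matter: everything earlier lies in [0, tau m],
       which is short compared with tau (m + 1) < T. *)
    have sub: "W \<inter> {0..T} \<subseteq> {0..\<tau> m} \<union> (S m \<inter> {0..\<tau> (Suc m)}) \<union> (S (Suc m) \<inter> {0..T})"
    proof
      fix x assume "x \<in> W \<inter> {0..T}"
      then obtain j where j: "x \<in> S j" "\<tau> j < x" "x \<le> \<tau> (Suc j)" "0 \<le> x" "x \<le> T" by (auto simp: W_def)
      have "j \<le> Suc m"
      proof (rule ccontr)
        assume "\<not> j \<le> Suc m"
        with \<tau>_mono[of "Suc (Suc m)" j] j k m(1) show False by simp
      qed
      then consider "j = Suc m" | "j = m" | "Suc j \<le> m" by linarith
      then show "x \<in> {0..\<tau> m} \<union> (S m \<inter> {0..\<tau> (Suc m)}) \<union> (S (Suc m) \<inter> {0..T})"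
        using j \<tau>_mono[of "Suc j" m] by cases auto
    qed
    have fm: "S j \<inter> {0..a} \<in> fmeasurable lebesgue" for j a
      by (rule fmeasurableI2[of "{0..a}"]) (auto intro!: sets.Int S(1))
    have "measure lebesgue (W \<inter> {0..T})
        \<le> measure lebesgue ({0..\<tau> m} \<union> (S m \<inter> {0..\<tau> (Suc m)}) \<union> (S (Suc m) \<inter> {0..T}))"
      by (rule measure_mono_fmeasurable[OF sub]) (auto intro!: sets.Int W_sets fm)
    also have "\<dots> \<le> measure lebesgue ({0..\<tau> m} \<union> (S m \<inter> {0..\<tau> (Suc m)})) + measure lebesgue (S (Suc m) \<inter> {0..T})"
      by (rule measure_Un_le) (auto intro!: sets.Int sets.Un S(1))
    also have "measure lebesgue ({0..\<tau> m} \<union> (S m \<inter> {0..\<tau> (Suc m)}))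
        \<le> measure lebesgue {0..\<tau> m} + measure lebesgue (S m \<inter> {0..\<tau> (Suc m)})"
      by (rule measure_Un_le) (auto intro!: sets.Int sets.Un S(1))
    also have "measure lebesgue {0..\<tau> m} = \<tau> m" using \<tau>_ge1[of m] by simp
    also have "\<tau> m \<le> T / real (Suc m)"
      using \<tau>_growth[of m] km by (simp add: pos_le_divide_eq mult.commute)
    also have "measure lebesgue (S m \<inter> {0..\<tau> (Suc m)}) \<le> T / real (Suc m)"
      using S_density[of m "\<tau> (Suc m)"] \<tau>_mono[of m "Suc m"] km
        divide_right_mono[of "\<tau> (Suc m)" T "real (Suc m)"] by simp
    also have "measure lebesgue (S (Suc m) \<inter> {0..T}) \<le> T / real (Suc m)"
    proof -
      have "T / real (Suc (Suc m)) \<le> T / real (Suc m)" using T0 by (intro divide_left_mono) auto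
      with S_density[of "Suc m" T] km show ?thesis by simp
    qed
    finally have "measure lebesgue (W \<inter> {0..T}) \<le> 3 * (T / real (Suc m))" by simp
    also have "\<dots> \<le> 3 * (T / real (Suc n))"
      using T0 m(2) by (intro mult_left_mono divide_left_mono) auto
    finally show ?thesis using T0 by (simp add: pos_divide_le_eq mult.commute)
  qed
  have "((\<lambda>T. measure lebesgue (W \<inter> {0..T}) / T) \<longlongrightarrow> 0) at_top"
  proof (rule tendstoI)
    fix r :: real assume "r > 0"
    then obtain n where n: "3 / r < real n" using reals_Archimedean2 by blast
    then have "3 / real (Suc n) < r" using \<open>r > 0\<close> by (simp add: field_simps)
    with W_density[of n] show "\<forall>\<^sub>F T in at_top. dist (measure lebesgue (W \<inter> {0..T}) / T) 0 < r"
      by (intro eventually_mono[OF eventually_gt_at_top[of "max 0 (\<tau> (Suc n))"]]) fastforce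
  qed
  with W_sets W_sub have "density_null W" by (simp add: density_null_def)
  with assms(2) have "(\<lambda>T. I (W \<inter> {0..T})) \<in> o[at_top](F)"
    unfolding not_CNS_def I_def F_def by blast
  from landau_o.smallD[OF this, of "\<epsilon> / 2"] assms(4)
  have "\<forall>\<^sub>F T in at_top. norm (I (W \<inter> {0..T})) \<le> \<epsilon> / 2 * norm (F T)" by simp
  then obtain T0 where T0: "\<And>T. T \<ge> T0 \<Longrightarrow> norm (I (W \<inter> {0..T})) \<le> \<epsilon> / 2 * norm (F T)"
    by (auto simp: eventually_at_top_linorder)
  define k where "k = nat \<lceil>T0\<rceil>"
  let ?T = "\<tau> (Suc k)"
  have "T0 \<le> ?T" using \<tau>_ge[of "Suc k"] unfolding k_def by linarith
  with T0[of ?T] F_nonneg have W_le: "I (W \<inter> {0..?T}) \<le> \<epsilon> / 2 * F ?T" by simp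
  have "I (S k \<inter> {0..?T}) \<le> I ({0..\<tau> k} \<union> (W \<inter> {0..?T}))"
  proof (rule I_mono[of _ _ ?T])
    show "S k \<inter> {0..?T} \<subseteq> {0..\<tau> k} \<union> (W \<inter> {0..?T})" by (auto simp: W_def)
    show "{0..\<tau> k} \<union> (W \<inter> {0..?T}) \<subseteq> {0..?T}" using \<tau>_mono[of k "Suc k"] by auto
  qed (auto intro!: sets.Un sets.Int S(1) W_sets)
  also have "\<dots> \<le> F (\<tau> k) + I (W \<inter> {0..?T})"
    unfolding F_def by (rule I_Un[of _ _ ?T]) (use \<tau>_mono[of k "Suc k"] in \<open>auto intro!: sets.Int W_sets\<close>)
  also have "\<dots> \<le> \<epsilon> / 2 * F ?T + \<epsilon> / 2 * F ?T" using F_step[of k] W_le by (rule add_mono)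
  finally show False using S_mass[of k] by simp
qed

lemma integral_lebesgue_on_Int:
  fixes h :: "real \<Rightarrow> real"
  assumes "S \<in> sets lebesgue"
  shows "(LINT t|lebesgue_on (S \<inter> {0..T}). h t) = (LINT t|lebesgue_on {0..T}. indicator S t * h t)"
proof -
  have "S \<inter> {0..T} \<in> sets lebesgue" "{0..T} \<in> sets lebesgue" using assms by auto
  then show ?thesis
    by (simp only: integral_lebesgue_on_eq_indicator indicator_inter_arith mult.assoc mult.left_commute)
qed

lemma mean_upto_indicator:
  assumes "S \<in> sets lebesgue"
  shows "mean_upto T (indicator S) = measure lebesgue (S \<inter> {0..T}) / T"
proof -
  have *: "S \<inter> {0..T} \<in> sets lebesgue" using assms by auto
  have "(LINT t|lebesgue_on {0..T}. indicator S t) = (LINT t|lebesgue_on (S \<inter> {0..T}). 1 :: real)"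
    by (simp only: integral_lebesgue_on_Int[OF assms] mult_1_right)
  also have "\<dots> = measure lebesgue (S \<inter> {0..T})"
    by (simp only: integral_lebesgue_on_eq_indicator[OF *]) simp
  finally show ?thesis by (simp add: mean_upto_def)
qed

text \<open>
  Passage from sets to weights by Chebyshev's inequality, applied to the set where \<open>w > \<epsilon> / 2\<close>.
\<close>
lemma not_CNS_uniform_weight:
  assumes "f \<in> L2_loc" "not_CNS f" "\<not> has_bnorm f 0" "\<epsilon> > 0"
  obtains \<delta> where "\<delta> > 0"
    "\<And>w. half_measurable w \<Longrightarrow> (\<And>t. 0 \<le> t \<Longrightarrow> 0 \<le> w t \<and> w t \<le> (1 :: real)) \<Longrightarrow>
       \<forall>\<^sub>F T in at_top. mean_upto T w \<le> \<delta> \<Longrightarrow>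
       \<forall>\<^sub>F T in at_top. mean_upto T (\<lambda>t. (cmod (f t))\<^sup>2 * w t) \<le> \<epsilon> * mean_sq T f"
proof -
  define \<kappa> where "\<kappa> = \<epsilon> / 2"
  have "\<kappa> > 0" using assms(4) by (simp add: \<kappa>_def)
  obtain d where d: "d > 0"
    "\<And>S. S \<in> sets lebesgue \<Longrightarrow> S \<subseteq> {0..} \<Longrightarrow>
       \<forall>\<^sub>F T in at_top. measure lebesgue (S \<inter> {0..T}) \<le> d * T \<Longrightarrow>
       \<forall>\<^sub>F T in at_top. (LINT t|lebesgue_on (S \<inter> {0..T}). (cmod (f t))\<^sup>2)
         \<le> \<kappa> * (LINT t|lebesgue_on {0..T}. (cmod (f t))\<^sup>2)"
    by (rule not_CNS_uniform[OF assms(1-3) \<open>\<kappa> > 0\<close>]) blast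
  have "\<forall>\<^sub>F T in at_top. mean_upto T (\<lambda>t. (cmod (f t))\<^sup>2 * w t) \<le> \<epsilon> * mean_sq T f"
    if w: "half_measurable w" "\<And>t. 0 \<le> t \<Longrightarrow> 0 \<le> w t \<and> w t \<le> (1 :: real)"
      and small: "\<forall>\<^sub>F T in at_top. mean_upto T w \<le> \<kappa> * d" for w
  proof -
    define S where "S = {t \<in> {0..}. \<kappa> < w t}"
    have "{t \<in> space (lebesgue_on {0..}). \<kappa> < w t} \<in> sets (lebesgue_on {0..})"
      using w(1) by measurable
    then have S: "S \<in> sets lebesgue" "S \<subseteq> {0..}"
      by (auto simp: S_def sets_restrict_space_iff)
    have ind: "half_measurable (indicator S :: real \<Rightarrow> real)"
      using S(1) by (intro measurable_restrict_space1 borel_measurable_indicator)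
    have Sint: "loc_int (indicator S :: real \<Rightarrow> real)"
      by (rule loc_int_weight[OF ind]) (simp add: indicator_def)
    have "\<forall>\<^sub>F T in at_top. measure lebesgue (S \<inter> {0..T}) \<le> d * T"
      using small eventually_gt_at_top[of 0]
    proof eventually_elim
      case (elim T)
      have "\<kappa> * mean_upto T (indicator S) = mean_upto T (\<lambda>t. \<kappa> * indicator S t)" by (rule mean_upto_mult_left[symmetric])
      also have "\<dots> \<le> mean_upto T w"
        by (intro mean_upto_mono loc_int_mult_left Sint loc_int_weight w elim)
          (use w(2) in \<open>auto simp: S_def indicator_def\<close>)
      also have "\<dots> \<le> \<kappa> * d" by (rule elim)
      finally have "mean_upto T (indicator S :: real \<Rightarrow> real) \<le> d" using \<open>\<kappa> > 0\<close> by simp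
      moreover have "mean_upto T (indicator S :: real \<Rightarrow> real) = measure lebesgue (S \<inter> {0..T}) / T"
        by (rule mean_upto_indicator[OF S(1)])
      ultimately show ?case using elim by (simp add: pos_divide_le_eq)
    qed
    from d(2)[OF S this]
    show ?thesis using eventually_gt_at_top[of 0]
    proof eventually_elim
      case (elim T)
      have ind01: "(0 :: real) \<le> indicator S t \<and> indicator S t \<le> (1 :: real)" for t by (simp add: indicator_def)
      note li = loc_int_sq_mult_weight[OF assms(1) ind ind01] loc_int_mult_left[OF L2_loc_loc_int_sq[OF assms(1)], of \<kappa>]
      have "mean_upto T (\<lambda>t. (cmod (f t))\<^sup>2 * w t)
          \<le> mean_upto T (\<lambda>t. (cmod (f t))\<^sup>2 * indicator S t + \<kappa> * (cmod (f t))\<^sup>2)"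
      proof (rule mean_upto_mono[OF loc_int_sq_mult_weight[OF assms(1) w] loc_int_add[OF li] elim(2)])
        fix t :: real assume t: "0 \<le> t"
        have "w t \<le> indicator S t + \<kappa>" using w(2)[OF t] t \<open>\<kappa> > 0\<close> by (auto simp: S_def indicator_def)
        from mult_left_mono[OF this, of "(cmod (f t))\<^sup>2"]
        show "(cmod (f t))\<^sup>2 * w t \<le> (cmod (f t))\<^sup>2 * indicator S t + \<kappa> * (cmod (f t))\<^sup>2"
          by (simp add: algebra_simps)
      qed
      also have "\<dots> = mean_upto T (\<lambda>t. (cmod (f t))\<^sup>2 * indicator S t) + \<kappa> * mean_sq T f"
        unfolding mean_upto_mult_left[symmetric] by (rule mean_upto_add[OF li elim(2)])
      also have "mean_upto T (\<lambda>t. (cmod (f t))\<^sup>2 * indicator S t) \<le> \<kappa> * mean_sq T f"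
      proof -
        have "(LINT t|lebesgue_on {0..T}. (cmod (f t))\<^sup>2 * indicator S t)
            \<le> \<kappa> * (LINT t|lebesgue_on {0..T}. (cmod (f t))\<^sup>2)"
          using elim(1) by (simp add: integral_lebesgue_on_Int[OF S(1)] mult.commute)
        from divide_right_mono[OF this, of T] elim(2) show ?thesis by (simp add: mean_upto_def)
      qed
      finally show ?case by (simp add: \<kappa>_def)
    qed
  qed
  with \<open>\<kappa> > 0\<close> d(1) show thesis using that[of "\<kappa> * d"] by simp
qed

text \<open>
  Uniform integrability makes the mass on a null set \<open>o(T)\<close>, while the total mass grows at least
  linearly when \<open>\<parallel>f\<parallel> \<noteq> 0\<close>.
\<close>
lemma B2_imp_not_CNS:
  assumes "f \<in> B2" "\<not> has_bnorm f 0"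
  shows "not_CNS f"
  unfolding not_CNS_def
proof (intro allI impI)
  fix S assume S: "density_null S"
  then have Ss: "S \<in> sets lebesgue" and dens: "((\<lambda>T. measure lebesgue (S \<inter> {0..T}) / T) \<longlongrightarrow> 0) at_top"
    by (auto simp: density_null_def)
  have ind: "half_measurable (indicator S :: real \<Rightarrow> real)"
    using Ss by (intro measurable_restrict_space1 borel_measurable_indicator)
  obtain c where c: "c > 0" "\<forall>\<^sub>F T in at_top. c \<le> mean_sq T f"
    using B2_mean_sq_bounded_below[OF assms] .
  show "(\<lambda>T. LINT t|lebesgue_on (S \<inter> {0..T}). (cmod (f t))\<^sup>2)
       \<in> o[at_top](\<lambda>T. LINT t|lebesgue_on {0..T}. (cmod (f t))\<^sup>2)"
  proof (rule landau_o.smallI)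
    fix r :: real assume "r > 0"
    define \<epsilon> where "\<epsilon> = r * c / 2"
    have "\<epsilon> > 0" using \<open>r > 0\<close> c(1) by (simp add: \<epsilon>_def)
    obtain B where B: "B \<ge> 0"
      "\<forall>\<^sub>F T in at_top. \<forall>w. half_measurable w \<longrightarrow> (\<forall>t\<ge>0. 0 \<le> w t \<and> w t \<le> 1) \<longrightarrow>
       mean_upto T (\<lambda>t. (cmod (f t))\<^sup>2 * w t) \<le> \<epsilon> + B * mean_upto T w"
      using B2_uniformly_integrable[OF assms(1) \<open>\<epsilon> > 0\<close>] by blast
    have "0 < \<epsilon> / (B + 1)" using \<open>\<epsilon> > 0\<close> B(1) by simp
    from order_tendstoD(2)[OF dens this]
    show "\<forall>\<^sub>F T in at_top. norm (LINT t|lebesgue_on (S \<inter> {0..T}). (cmod (f t))\<^sup>2)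
        \<le> r * norm (LINT t|lebesgue_on {0..T}. (cmod (f t))\<^sup>2)"
      using B(2) c(2) eventually_gt_at_top[of 0]
    proof eventually_elim
      case (elim T)
      have "mean_upto T (\<lambda>t. (cmod (f t))\<^sup>2 * indicator S t) \<le> \<epsilon> + B * (measure lebesgue (S \<inter> {0..T}) / T)"
        using elim(2)[rule_format, OF ind] by (simp add: mean_upto_indicator[OF Ss] indicator_def)
      also have "B * (measure lebesgue (S \<inter> {0..T}) / T) \<le> (B + 1) * (\<epsilon> / (B + 1))"
        using elim(1,4) B(1) by (intro mult_mono) auto
      also have "\<dots> = \<epsilon>" using B(1) by simp
      also have "\<epsilon> + \<epsilon> = r * c" by (simp add: \<epsilon>_def)
      also have "\<dots> \<le> r * mean_sq T f" using elim(3) \<open>r > 0\<close> by simp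
      finally have "T * mean_upto T (\<lambda>t. (cmod (f t))\<^sup>2 * indicator S t) \<le> T * (r * mean_sq T f)"
        using elim(4) by (intro mult_left_mono) auto
      then have "(LINT t|lebesgue_on {0..T}. indicator S t * (cmod (f t))\<^sup>2)
          \<le> r * (LINT t|lebesgue_on {0..T}. (cmod (f t))\<^sup>2)"
        using elim(4) by (simp add: mean_upto_def mult.commute)
      then show ?case by (simp add: integral_lebesgue_on_Int[OF Ss])
    qed
  qed
qed

section \<open>Bounded multipliers on \<open>A2\<close>\<close>

text \<open>
  Squaring a locally square integrable function leads only to a locally integrable one, which is not
  a representative in \<open>A2\<close>. On each \<open>[n, n + 1)\<close> the values above a height \<open>M n\<close> are cut off, where
  \<open>M n\<close> is so large that the total loss over the whole half-line is at most \<open>\<Sum>n. 2\<^sup>-\<^sup>n = 2\<close>. A finite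
  loss vanishes in the mean, so all averages are unchanged.
\<close>
lemma exists_L2_loc_close_in_mean:
  fixes \<psi> :: "real \<Rightarrow> complex"
  assumes "half_measurable \<psi>" "loc_int \<psi>"
  obtains \<psi>' where "\<psi>' \<in> L2_loc" "((\<lambda>T. mean_upto T (\<lambda>t. cmod (\<psi> t - \<psi>' t))) \<longlongrightarrow> 0) at_top"
proof -
  define tail where "tail m t = (if real m < cmod (\<psi> t) then cmod (\<psi> t) else 0)" for m :: nat and t
  note [measurable] = assms(1)
  have tail_meas: "half_measurable (tail m)" for m unfolding tail_def by measurable
  have "\<exists>m. (LINT t|lebesgue_on {0..real n + 1}. tail m t) \<le> (1 / 2) ^ n" for n
  proof -
    have int: "integrable (lebesgue_on {0..real n + 1}) (\<lambda>t. cmod (\<psi> t))"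
      using assms(2) by (auto simp: loc_int_def)
    have "(\<lambda>m. LINT t|lebesgue_on {0..real n + 1}. tail m t) \<longlonglongrightarrow> (LINT t|lebesgue_on {0..real n + 1}. 0)"
    proof (rule integral_dominated_convergence[OF _ _ int])
      show "tail m \<in> borel_measurable (lebesgue_on {0..real n + 1})" for m
        by (rule half_measurable_upto[OF tail_meas])
      show "AE t in lebesgue_on {0..real n + 1}. (\<lambda>m. tail m t) \<longlonglongrightarrow> 0"
      proof (rule AE_I2)
        fix t
        obtain k where k: "cmod (\<psi> t) \<le> real k" using real_arch_simple by blast
        have "tail m t = 0" if "k \<le> m" for m
          using k that by (auto simp: tail_def)
        then show "(\<lambda>m. tail m t) \<longlonglongrightarrow> 0"
          by (intro tendsto_eventually) (auto simp: eventually_sequentially)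
      qed
      show "AE t in lebesgue_on {0..real n + 1}. norm (tail m t) \<le> cmod (\<psi> t)" for m
        by (simp add: tail_def)
    qed simp
    then have "(\<lambda>m. LINT t|lebesgue_on {0..real n + 1}. tail m t) \<longlonglongrightarrow> 0" by simp
    from order_tendstoD(2)[OF this, of "(1 / 2) ^ n"]
    obtain m where "(LINT t|lebesgue_on {0..real n + 1}. tail m t) < (1 / 2) ^ n"
      by (auto simp: eventually_sequentially)
    then show ?thesis by (intro exI[of _ m]) simp
  qed
  then obtain M where M: "\<And>n. (LINT t|lebesgue_on {0..real n + 1}. tail (M n) t) \<le> (1 / 2) ^ n" by metis
  define \<psi>' where "\<psi>' t = (if cmod (\<psi> t) \<le> real (M (nat \<lfloor>t\<rfloor>)) then \<psi> t else 0)" for t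
  have M_meas: "half_measurable (\<lambda>t. real (M (nat \<lfloor>t\<rfloor>)))"
  proof -
    have "(\<lambda>t::real. real (M (nat \<lfloor>t\<rfloor>))) \<in> borel_measurable borel" by measurable
    then have "(\<lambda>t::real. real (M (nat \<lfloor>t\<rfloor>))) \<in> borel_measurable lebesgue"
      by (intro measurable_completion) simp
    then show ?thesis by (rule measurable_restrict_space1)
  qed
  note [measurable] = M_meas
  have \<psi>'_meas: "half_measurable \<psi>'" unfolding \<psi>'_def by measurable
  show thesis
  proof (rule that)
    show "\<psi>' \<in> L2_loc"
      unfolding L2_loc_def
    proof (intro CollectI conjI allI impI \<psi>'_meas)
      fix T :: real assume "T > 0"
      define b where "b = Max (M ` {..nat \<lfloor>T\<rfloor>})"
      have "(\<lambda>t. \<psi>' t) \<in> borel_measurable (lebesgue_on {0..T})" by (rule half_measurable_upto[OF \<psi>'_meas])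
      then have meas: "(\<lambda>t. (cmod (\<psi>' t))\<^sup>2) \<in> borel_measurable (lebesgue_on {0..T})" by simp
      have "integrable (lebesgue_on {0..T}) (\<lambda>t. (real b)\<^sup>2)"
        using loc_int_const[of "(real b)\<^sup>2"] \<open>T > 0\<close> by (simp only: loc_int_def)
      then show "integrable (lebesgue_on {0..T}) (\<lambda>t. (cmod (\<psi>' t))\<^sup>2)"
      proof (rule Bochner_Integration.integrable_bound[OF _ meas], intro AE_I2)
        fix t assume "t \<in> space (lebesgue_on {0..T})"
        then have "nat \<lfloor>t\<rfloor> \<le> nat \<lfloor>T\<rfloor>" by (auto intro!: nat_mono floor_mono)
        then have "M (nat \<lfloor>t\<rfloor>) \<le> b" unfolding b_def by (intro Max_ge) auto
        then have "cmod (\<psi>' t) \<le> real b" by (auto simp: \<psi>'_def)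
        then show "norm ((cmod (\<psi>' t))\<^sup>2) \<le> norm ((real b)\<^sup>2)" by (simp add: power_mono)
      qed
    qed
    have tail_int: "integrable (lebesgue_on {0..T}) (tail m)" for m T
    proof (rule integrable_lebesgue_on_subset)
      have "loc_int (tail m)"
        by (rule loc_int_bound[OF tail_meas loc_int_norm[OF assms(2)]]) (simp add: tail_def)
      then show "integrable (lebesgue_on {0..max T 1}) (tail m)" by (simp add: loc_int_def)
    qed auto
    have bound: "(LINT t|lebesgue_on {0..T}. cmod (\<psi> t - \<psi>' t)) \<le> 2" if "T > 0" for T
    proof -
      define n where "n = nat \<lfloor>T\<rfloor>"
      have part: "integrable (lebesgue_on {0..T}) (\<lambda>t. indicator {0..real k + 1} t * tail (M k) t)"
        "(LINT t|lebesgue_on {0..T}. indicator {0..real k + 1} t * tail (M k) t) \<le> (1 / 2) ^ k" for k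
      proof -
        have sets: "{0..T} \<in> sets lebesgue" "{0..T} \<inter> {0..real k + 1} \<in> sets lebesgue" by auto
        have "integrable (lebesgue_on ({0..T} \<inter> {0..real k + 1})) (tail (M k))"
          by (rule integrable_lebesgue_on_subset[OF tail_int[of T]]) auto
        then show "integrable (lebesgue_on {0..T}) (\<lambda>t. indicator {0..real k + 1} t * tail (M k) t)"
          by (simp only: integrable_lebesgue_on_iff[OF sets(1)] integrable_lebesgue_on_iff[OF sets(2)]
              indicator_inter_arith mult.assoc)
        have "(LINT t|lebesgue_on {0..T}. indicator {0..real k + 1} t * tail (M k) t)
            = (LINT t|lebesgue_on ({0..real k + 1} \<inter> {0..T}). tail (M k) t)"
          by (rule integral_lebesgue_on_Int[symmetric]) auto
        also have "\<dots> \<le> (LINT t|lebesgue_on {0..real k + 1}. tail (M k) t)"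
          by (rule integral_lebesgue_on_mono[OF tail_int]) (auto simp: tail_def)
        also have "\<dots> \<le> (1 / 2) ^ k" by (rule M)
        finally show "(LINT t|lebesgue_on {0..T}. indicator {0..real k + 1} t * tail (M k) t) \<le> (1 / 2) ^ k" .
      qed
      have "(LINT t|lebesgue_on {0..T}. cmod (\<psi> t - \<psi>' t))
          \<le> (LINT t|lebesgue_on {0..T}. (\<Sum>k\<le>n. indicator {0..real k + 1} t * tail (M k) t))"
      proof (rule integral_mono)
        show "integrable (lebesgue_on {0..T}) (\<lambda>t. \<Sum>k\<le>n. indicator {0..real k + 1} t * tail (M k) t)"
          by (intro Bochner_Integration.integrable_sum part)
        have "loc_int (\<lambda>t. cmod (\<psi> t - \<psi>' t))"
        proof (rule loc_int_bound[OF _ loc_int_norm[OF assms(2)]])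
          show "half_measurable (\<lambda>t. cmod (\<psi> t - \<psi>' t))" using \<psi>'_meas by simp
        qed (simp add: \<psi>'_def)
        then show "integrable (lebesgue_on {0..T}) (\<lambda>t. cmod (\<psi> t - \<psi>' t))"
          using that by (simp add: loc_int_def)
        fix t assume "t \<in> space (lebesgue_on {0..T})"
        then have t: "0 \<le> t" "t \<le> T" by auto
        let ?k = "nat \<lfloor>t\<rfloor>"
        have k: "?k \<le> n" unfolding n_def using t by (intro nat_mono floor_mono)
        have "t \<le> real ?k + 1" using t by linarith
        then have "cmod (\<psi> t - \<psi>' t) \<le> indicator {0..real ?k + 1} t * tail (M ?k) t"
          using t by (simp add: \<psi>'_def tail_def)
        also have "\<dots> \<le> (\<Sum>k\<le>n. indicator {0..real k + 1} t * tail (M k) t)"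
          using k by (intro member_le_sum) (auto simp: tail_def)
        finally show "cmod (\<psi> t - \<psi>' t) \<le> (\<Sum>k\<le>n. indicator {0..real k + 1} t * tail (M k) t)" .
      qed
      also have "\<dots> = (\<Sum>k\<le>n. LINT t|lebesgue_on {0..T}. indicator {0..real k + 1} t * tail (M k) t)"
        by (intro Bochner_Integration.integral_sum part)
      also have "\<dots> \<le> (\<Sum>k\<le>n. (1 / 2) ^ k)" by (intro sum_mono part)
      also have "\<dots> \<le> 2" 
      proof -
        have "(\<Sum>k\<le>n. (1 / 2) ^ k) = 2 - (1 / 2 :: real) ^ n" by (induction n) auto
        then show ?thesis by simp
      qed
      finally show ?thesis .
    qed
    show "((\<lambda>T. mean_upto T (\<lambda>t. cmod (\<psi> t - \<psi>' t))) \<longlongrightarrow> 0) at_top"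
    proof (rule Lim_null_comparison)
      show "\<forall>\<^sub>F T in at_top. norm (mean_upto T (\<lambda>t. cmod (\<psi> t - \<psi>' t))) \<le> 2 / T"
        using eventually_gt_at_top[of 0]
      proof eventually_elim
        case (elim T)
        then show ?case using divide_right_mono[OF bound[OF elim], of T]
          by (simp add: mean_upto_def)
      qed
      show "((\<lambda>T. 2 / T) \<longlongrightarrow> (0 :: real)) at_top"
        by (rule const_divide_tendsto_0)
    qed
  qed
qed

lemma orthogonal_e_cnj:
  assumes "orthogonal_e \<phi>" shows "orthogonal_e (\<lambda>t. cnj (\<phi> t))"
  unfolding orthogonal_e_def has_binner_def
proof
  fix l
  have "((\<lambda>T. cnj (mean_upto T (\<lambda>t. \<phi> t * cnj (e (- l) t)))) \<longlongrightarrow> cnj 0) at_top"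
    using assms unfolding orthogonal_e_def has_binner_def by (intro tendsto_cnj) blast
  then show "((\<lambda>T. mean_upto T (\<lambda>t. cnj (\<phi> t) * cnj (e l t))) \<longlongrightarrow> 0) at_top"
    by (simp add: mean_upto_cnj[symmetric] cnj_e)
qed

lemma has_binner_binner: "has_binner f g c \<Longrightarrow> binner f g = c"
  unfolding has_binner_def binner_def by (rule tendsto_Lim) simp_all

text \<open>
  \<open>\<phi>\<close> represents the zero class, and a bounded operator maps the zero class to itself.
\<close>
lemma orthogonal_e_multiplier:
  assumes "bounded_multiplier_A2 u" "\<phi> \<in> L2_loc" "orthogonal_e \<phi>"
  shows "orthogonal_e (\<lambda>t. u t * \<phi> t)"
proof -
  have b0: "binner \<phi> (e l) = 0" for l
    using assms(3) has_binner_binner by (auto simp: orthogonal_e_def)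
  have "\<phi> \<in> A2" "A2_norm \<phi> = 0"
    using assms(2,3) b0 by (auto simp: A2_def A2_norm_def orthogonal_e_def)
  with assms(1) have A2: "(\<lambda>t. u t * \<phi> t) \<in> A2" and "A2_norm (\<lambda>t. u t * \<phi> t) \<le> 0"
    unfolding bounded_multiplier_A2_def by fastforce+
  then have "(\<Sum>\<^sub>\<infinity>l. (cmod (binner (\<lambda>t. u t * \<phi> t) (e l)))\<^sup>2) \<le> 0"
    by (simp add: A2_norm_def)
  then have "(cmod (binner (\<lambda>t. u t * \<phi> t) (e l)))\<^sup>2 = 0" for l
    by (rule nonneg_infsum_le_0D) (use A2 in \<open>auto simp: A2_def\<close>)
  then have "binner (\<lambda>t. u t * \<phi> t) (e l) = 0" for l by simp
  with A2 show ?thesis unfolding A2_def orthogonal_e_def using has_binner_binner by fastforce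
qed

text \<open>
  Conjugation preserves orthogonality, so \<open>cnj u\<close> inherits from \<open>u\<close> that it preserves orthogonality.
\<close>
lemma orthogonal_e_cnj_multiplier:
  assumes "bounded_multiplier_A2 u" "\<phi> \<in> L2_loc" "orthogonal_e \<phi>"
  shows "orthogonal_e (\<lambda>t. cnj (u t) * \<phi> t)"
  using orthogonal_e_cnj[OF orthogonal_e_multiplier[OF assms(1) L2_loc_cnj[OF assms(2)] orthogonal_e_cnj[OF assms(3)]]]
  by simp

section \<open>Comparison of the mean squares\<close>

text \<open>
  For \<open>\<epsilon> = 1 / 2\<close> the hypothesis turns the bound on \<open>G\<close> into a bound on \<open>A\<close>; with \<open>A\<close> bounded, the relative
  error becomes an absolute one.
\<close>
lemma real_tendsto_0_if_relatively_close:
  fixes A G :: "real \<Rightarrow> real"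
  assumes close: "\<And>\<epsilon>. \<epsilon> > 0 \<Longrightarrow> \<forall>\<^sub>F T in at_top. \<bar>A T - G T\<bar> \<le> \<epsilon> + \<epsilon> * A T"
    and G: "\<forall>\<^sub>F T in at_top. G T \<le> C" and A: "\<forall>\<^sub>F T in at_top. 0 \<le> A T"
  shows "((\<lambda>T. A T - G T) \<longlongrightarrow> 0) at_top"
proof (rule tendstoI)
  fix r :: real assume "r > 0"
  define K where "K = 2 * \<bar>C\<bar> + 2"
  have "K > 0" by (simp add: K_def add_nonneg_pos)
  define \<epsilon> where "\<epsilon> = r / (2 * (1 + K))"
  have "\<epsilon> > 0" using \<open>r > 0\<close> \<open>K > 0\<close> by (simp add: \<epsilon>_def)
  have "0 < (1 / 2 :: real)" by simp
  show "\<forall>\<^sub>F T in at_top. dist (A T - G T) 0 < r"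
    using close[OF \<open>0 < 1 / 2\<close>] close[OF \<open>\<epsilon> > 0\<close>] G A
  proof eventually_elim
    case (elim T)
    have "A T \<le> K" using elim by (auto simp: K_def abs_le_iff)
    then have "\<epsilon> + \<epsilon> * A T \<le> \<epsilon> * (1 + K)" using \<open>\<epsilon> > 0\<close> by (simp add: distrib_left)
    also have "\<dots> = r / 2" using \<open>K > 0\<close> by (simp add: \<epsilon>_def field_simps)
    finally show ?case using elim \<open>r > 0\<close> by simp
  qed
qed

text \<open>
  The Bohr functions \<open>V N\<close> have modulus 1, so the approximation in mean square comes with the uniform
  bound 2, which a general approximation in \<open>B2\<close> does not provide. It is essential for keeping the
  weights \<open>cmod (u\<^sup>2 - Q\<^sup>2)\<close> bounded when they are integrated against \<open>\<bar>f\<bar>\<^sup>2\<close>.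
\<close>
lemma exists_trig_poly_near_Bohr_limit:
  assumes "u \<in> L2_loc" "v \<in> L2_loc" "((\<lambda>T. mean_sq T (\<lambda>t. u t - v t)) \<longlongrightarrow> 0) at_top"
    and "\<And>N. V N \<in> Bohr" "\<And>N t. 0 \<le> t \<Longrightarrow> cmod (V N t) = 1" "converges_in_B2 V v" "\<eta> > 0"
  obtains Q where "trig_poly Q" "\<And>t. 0 \<le> t \<Longrightarrow> cmod (Q t) \<le> 2"
    "\<forall>\<^sub>F T in at_top. mean_sq T (\<lambda>t. u t - Q t) \<le> \<eta>"
    "\<forall>\<^sub>F T in at_top. mean_sq T (\<lambda>t. v t - Q t) \<le> \<eta>"
proof -
  (* Each use of the triangle inequality for mean squares costs a factor 2: the distance of v from Q
     is below 4 d, that of u from Q below 10 d. *)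
  define d where "d = \<eta> / 16"
  have "d > 0" using assms(7) by (simp add: d_def)
  from assms(6) obtain r where r: "\<And>N. has_bnorm (\<lambda>t. v t - V N t) (r N)" "r \<longlonglongrightarrow> 0"
    by (auto simp: converges_in_B2_def)
  have "(\<lambda>N. (r N)\<^sup>2) \<longlonglongrightarrow> 0" using tendsto_power[OF r(2), of 2] by simp
  from order_tendstoD(2)[OF this \<open>d > 0\<close>] obtain N where N: "(r N)\<^sup>2 < d"
    by (auto simp: eventually_sequentially)
  have "((\<lambda>T. complex_of_real (mean_sq T (\<lambda>t. v t - V N t))) \<longlongrightarrow> complex_of_real ((r N)\<^sup>2)) at_top"
    using r(1)[of N] unfolding has_bnorm_def has_binner_def
    by (simp only: mean_upto_of_real[symmetric] complex_norm_square)
  then have "((\<lambda>T. mean_sq T (\<lambda>t. v t - V N t)) \<longlongrightarrow> (r N)\<^sup>2) at_top"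
    by (simp only: tendsto_of_real_iff)
  from order_tendstoD(2)[OF this N] have vV: "\<forall>\<^sub>F T in at_top. mean_sq T (\<lambda>t. v t - V N t) < d" .
  have "0 < min 1 (sqrt d)" using \<open>d > 0\<close> by simp
  from Bohr_uniform_approx[OF assms(4)[of N] this]
  obtain Q where Q: "trig_poly Q" "\<And>t. 0 \<le> t \<Longrightarrow> cmod (V N t - Q t) \<le> min 1 (sqrt d)" by blast
  note L2 = assms(1,2) Bohr_L2_loc[OF assms(4)[of N]] trig_poly_L2_loc[OF Q(1)]
  have vQ: "\<forall>\<^sub>F T in at_top. mean_sq T (\<lambda>t. v t - Q t) \<le> 4 * d"
    using vV eventually_gt_at_top[of 0]
  proof eventually_elim
    case (elim T)
    have "mean_sq T (\<lambda>t. V N t - Q t) \<le> (sqrt d)\<^sup>2"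
      using Q(2) elim(2) by (intro mean_sq_le_sup L2_loc_diff L2) auto
    with mean_sq_triangle[OF L2(2,3,4) elim(2)] elim(1) \<open>d > 0\<close> show ?case by simp
  qed
  have uQ: "\<forall>\<^sub>F T in at_top. mean_sq T (\<lambda>t. u t - Q t) \<le> \<eta>"
    using vQ order_tendstoD(2)[OF assms(3) \<open>d > 0\<close>] eventually_gt_at_top[of 0]
  proof eventually_elim
    case (elim T)
    with mean_sq_triangle[OF L2(1,2,4) elim(3)] assms(7) show ?case by (simp add: d_def)
  qed
  show thesis
  proof (rule that[OF Q(1) _ uQ])
    show "cmod (Q t) \<le> 2" if "0 \<le> t" for t
    proof -
      have "cmod (Q t) \<le> cmod (V N t) + cmod (V N t - Q t)"
        using norm_triangle_ineq4[of "V N t" "V N t - Q t"] by simp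
      with Q(2)[OF that] assms(5)[OF that] show ?thesis by simp
    qed
    show "\<forall>\<^sub>F T in at_top. mean_sq T (\<lambda>t. v t - Q t) \<le> \<eta>"
      using vQ by eventually_elim (use assms(7) in \<open>simp add: d_def\<close>)
  qed
qed

lemma cmod_square_diff_le:
  assumes "cmod a = 1" "cmod b \<le> 2"
  shows "cmod (a\<^sup>2 - b\<^sup>2) \<le> 3 * cmod (a - b)" "cmod (a\<^sup>2 - b\<^sup>2) \<le> 9"
proof -
  have "cmod (a + b) \<le> 3" using norm_triangle_ineq[of a b] assms by simp
  then show 1: "cmod (a\<^sup>2 - b\<^sup>2) \<le> 3 * cmod (a - b)"
    by (simp add: power2_eq_square square_diff_square_factored norm_mult mult_right_mono)
  have "cmod (a - b) \<le> 3" using norm_triangle_ineq4[of a b] assms by simp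
  with 1 show "cmod (a\<^sup>2 - b\<^sup>2) \<le> 9" by simp
qed

text \<open>
  \<open>u\<close> and \<open>v\<close> are the phases of \<open>f\<close> and \<open>g\<close>; the pairs \<open>f\<close>, \<open>g\<close> and \<open>f\<^sup>2\<close>, \<open>g\<^sup>2\<close> and \<open>u\<close>, \<open>v\<close> have equal
  coefficients.
\<close>
locale polar_pair =
  fixes f g u v :: "real \<Rightarrow> complex"
  assumes f: "f \<in> L2_loc" and g: "g \<in> B2" and u: "u \<in> B2" and v: "v \<in> B2"
    and u1: "\<And>t. 0 \<le> t \<Longrightarrow> cmod (u t) = 1" and v1: "\<And>t. 0 \<le> t \<Longrightarrow> cmod (v t) = 1"
    and fu: "\<And>t. 0 \<le> t \<Longrightarrow> f t = complex_of_real (cmod (f t)) * u t"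
    and gv: "\<And>t. 0 \<le> t \<Longrightarrow> g t = complex_of_real (cmod (g t)) * v t"
    and fg: "orthogonal_e (\<lambda>t. f t - g t)"
    and sq: "orthogonal_e (\<lambda>t. (f t)\<^sup>2 - (g t)\<^sup>2)"
    and uv: "orthogonal_e (\<lambda>t. u t - v t)"
begin

lemma L2_loc: "f \<in> L2_loc" "g \<in> L2_loc" "u \<in> L2_loc" "v \<in> L2_loc"
  using f g u v by (auto intro: B2_L2_loc)

lemma meas [measurable]: "half_measurable f" "half_measurable g" "half_measurable u" "half_measurable v"
  using L2_loc by (auto intro: L2_loc_measurable)

lemma cnj_meas [measurable]: "half_measurable (\<lambda>t. cnj (u t))" "half_measurable (\<lambda>t. cnj (v t))"
  by (intro half_measurable_cnj meas)+

lemma loc_int_sq: "loc_int (\<lambda>t. (f t)\<^sup>2)" "loc_int (\<lambda>t. (g t)\<^sup>2)"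
  unfolding power2_eq_square by (intro L2_loc_loc_int_mult L2_loc)+

lemma uv_close: "((\<lambda>T. mean_sq T (\<lambda>t. u t - v t)) \<longlongrightarrow> 0) at_top"
  by (rule B2_mean_sq_diff_unique[OF u v uv])

lemma cmod_sq_eq:
  assumes "0 \<le> t"
  shows "complex_of_real ((cmod (f t))\<^sup>2) = (f t)\<^sup>2 * (cnj (u t))\<^sup>2"
    and "complex_of_real ((cmod (g t))\<^sup>2) = (g t)\<^sup>2 * (cnj (v t))\<^sup>2"
proof -
  have *: "complex_of_real a ^ 2 = (complex_of_real a * w)\<^sup>2 * (cnj w)\<^sup>2" if "cmod w = 1" for a w
    using complex_norm_square[of w] that by (simp add: power_mult_distrib mult.assoc flip: power_mult_distrib[of w "cnj w"])
  show "complex_of_real ((cmod (f t))\<^sup>2) = (f t)\<^sup>2 * (cnj (u t))\<^sup>2"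
    using *[OF u1[OF assms], of "cmod (f t)"] fu[OF assms] by simp
  show "complex_of_real ((cmod (g t))\<^sup>2) = (g t)\<^sup>2 * (cnj (v t))\<^sup>2"
    using *[OF v1[OF assms], of "cmod (g t)"] gv[OF assms] by simp
qed

text \<open>
  Integrates the identity
  \<open>\<bar>f\<bar>\<^sup>2 - \<bar>g\<bar>\<^sup>2 = (f\<^sup>2 - g\<^sup>2) P + f\<^sup>2 (cnj u\<^sup>2 - P) - g\<^sup>2 (cnj v\<^sup>2 - P)\<close>,
  which holds because \<open>f\<^sup>2 cnj u\<^sup>2 = \<bar>f\<bar>\<^sup>2\<close> and \<open>g\<^sup>2 cnj v\<^sup>2 = \<bar>g\<bar>\<^sup>2\<close>. The factor \<open>P\<close> is an approximation to
  \<open>cnj u\<^sup>2\<close> and \<open>cnj v\<^sup>2\<close> for which the mean of the first term is known to vanish.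
\<close>
lemma mean_sq_diff_bound:
  assumes P: "half_measurable P" "\<And>t. 0 \<le> t \<Longrightarrow> cmod (P t) \<le> B" and T: "T > 0"
    and Wf: "loc_int (\<lambda>t. (cmod (f t))\<^sup>2 * cmod ((cnj (u t))\<^sup>2 - P t))"
    and Wg: "loc_int (\<lambda>t. (cmod (g t))\<^sup>2 * cmod ((cnj (v t))\<^sup>2 - P t))"
  shows "\<bar>mean_sq T f - mean_sq T g\<bar>
    \<le> cmod (mean_upto T (\<lambda>t. ((f t)\<^sup>2 - (g t)\<^sup>2) * P t))
      + mean_upto T (\<lambda>t. (cmod (f t))\<^sup>2 * cmod ((cnj (u t))\<^sup>2 - P t))
      + mean_upto T (\<lambda>t. (cmod (g t))\<^sup>2 * cmod ((cnj (v t))\<^sup>2 - P t))"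
proof -
  note [measurable] = P(1)
  let ?m = "\<lambda>t. ((f t)\<^sup>2 - (g t)\<^sup>2) * P t"
  let ?r = "\<lambda>t. (f t)\<^sup>2 * ((cnj (u t))\<^sup>2 - P t) - (g t)\<^sup>2 * ((cnj (v t))\<^sup>2 - P t)"
  let ?w = "\<lambda>t. (cmod (f t))\<^sup>2 * cmod ((cnj (u t))\<^sup>2 - P t) + (cmod (g t))\<^sup>2 * cmod ((cnj (v t))\<^sup>2 - P t)"
  have m_int: "loc_int ?m"
  proof (rule loc_int_bound[OF _ loc_int_mult_left[OF loc_int_norm[OF loc_int_diff[OF loc_int_sq]], of B]])
    show "norm (?m t) \<le> B * cmod ((f t)\<^sup>2 - (g t)\<^sup>2)" if "0 \<le> t" for t
      using mult_right_mono[OF P(2)[OF that], of "cmod ((f t)\<^sup>2 - (g t)\<^sup>2)"] by (simp add: norm_mult mult.commute)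
  qed measurable
  have r_meas: "half_measurable ?r" by measurable
  have w_int: "loc_int ?w" using Wf Wg by (rule loc_int_add)
  have r_le: "norm (?r t) \<le> ?w t" for t
    using norm_triangle_ineq4[of "(f t)\<^sup>2 * ((cnj (u t))\<^sup>2 - P t)" "(g t)\<^sup>2 * ((cnj (v t))\<^sup>2 - P t)"]
    by (simp add: norm_mult norm_power)
  have "complex_of_real (mean_sq T f - mean_sq T g)
      = mean_upto T (\<lambda>t. complex_of_real ((cmod (f t))\<^sup>2 - (cmod (g t))\<^sup>2))"
    by (simp only: mean_upto_of_real mean_upto_diff[OF L2_loc_loc_int_sq[OF L2_loc(1)] L2_loc_loc_int_sq[OF L2_loc(2)] T])
  also have "\<dots> = mean_upto T (\<lambda>t. ?m t + ?r t)"
    by (intro mean_upto_cong) (simp only: of_real_diff cmod_sq_eq, simp add: algebra_simps)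
  also have "\<dots> = mean_upto T ?m + mean_upto T ?r"
    by (rule mean_upto_add[OF m_int loc_int_bound[OF r_meas w_int r_le] T])
  finally have "cmod (complex_of_real (mean_sq T f - mean_sq T g)) = cmod (mean_upto T ?m + mean_upto T ?r)"
    by (rule arg_cong)
  then have "\<bar>mean_sq T f - mean_sq T g\<bar> = cmod (mean_upto T ?m + mean_upto T ?r)"
    by (simp only: norm_of_real)
  also have "\<dots> \<le> cmod (mean_upto T ?m) + cmod (mean_upto T ?r)" by (rule norm_triangle_ineq)
  also have "cmod (mean_upto T ?r) \<le> mean_upto T ?w"
    by (rule norm_mean_upto_le_mean[OF r_meas w_int r_le T])
  also have "mean_upto T ?w = mean_upto T (\<lambda>t. (cmod (f t))\<^sup>2 * cmod ((cnj (u t))\<^sup>2 - P t))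
      + mean_upto T (\<lambda>t. (cmod (g t))\<^sup>2 * cmod ((cnj (v t))\<^sup>2 - P t))"
    by (rule mean_upto_add[OF Wf Wg T])
  finally show ?thesis by simp
qed

lemma B2_if_mean_sq_diff_bound:
  assumes "\<And>\<epsilon>. \<epsilon> > 0 \<Longrightarrow> \<forall>\<^sub>F T in at_top. \<bar>mean_sq T f - mean_sq T g\<bar> \<le> \<epsilon> + \<epsilon> * mean_sq T f"
  shows "f \<in> B2"
proof (rule B2_if_same_mean_sq[OF g f fg])
  obtain C where C: "\<forall>\<^sub>F T in at_top. mean_sq T g \<le> C" using B2_mean_sq_bounded[OF g] .
  have "\<forall>\<^sub>F T in at_top. 0 \<le> mean_sq T f"
    by (rule eventually_mono[OF eventually_gt_at_top[of 0]]) (intro mean_upto_nonneg; simp)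
  from real_tendsto_0_if_relatively_close[OF assms C this]
  show "((\<lambda>T. mean_sq T f - mean_sq T g) \<longlongrightarrow> 0) at_top" .
qed

text \<open>
  Here \<open>P = cnj Q\<^sup>2\<close> for a trigonometric polynomial \<open>Q\<close> close to \<open>u\<close> and \<open>v\<close> in mean square. The first term
  then vanishes in the mean since \<open>f\<^sup>2 - g\<^sup>2\<close> is orthogonal to \<open>e l\<close> for all \<open>l\<close>; the weights in the
  other two are small in mean, and neither \<open>\<bar>f\<bar>\<^sup>2\<close> nor \<open>\<bar>g\<bar>\<^sup>2\<close> concentrates where they are not small.
\<close>
lemma B2_if_not_CNS:
  assumes "not_CNS f" "\<not> has_bnorm f 0"
    and V: "\<And>N. V N \<in> Bohr" "\<And>N t. 0 \<le> t \<Longrightarrow> cmod (V N t) = 1" "converges_in_B2 V v"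
  shows "f \<in> B2"
proof (rule B2_if_mean_sq_diff_bound)
  fix \<epsilon> :: real assume "\<epsilon> > 0"
  then have \<epsilon>9: "\<epsilon> / 9 > 0" "\<epsilon> / 36 > 0" by auto
  obtain \<delta> where \<delta>: "\<delta> > 0" "\<And>w. half_measurable w \<Longrightarrow> (\<And>t. 0 \<le> t \<Longrightarrow> 0 \<le> w t \<and> w t \<le> (1 :: real)) \<Longrightarrow>
       \<forall>\<^sub>F T in at_top. mean_upto T w \<le> \<delta> \<Longrightarrow>
       \<forall>\<^sub>F T in at_top. mean_upto T (\<lambda>t. (cmod (f t))\<^sup>2 * w t) \<le> \<epsilon> / 9 * mean_sq T f"
    by (rule not_CNS_uniform_weight[OF f assms(1,2) \<epsilon>9(1)]) blast
  obtain B where B: "B \<ge> 0"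
    "\<forall>\<^sub>F T in at_top. \<forall>w. half_measurable w \<longrightarrow> (\<forall>t\<ge>0. 0 \<le> w t \<and> w t \<le> 1) \<longrightarrow>
       mean_upto T (\<lambda>t. (cmod (g t))\<^sup>2 * w t) \<le> \<epsilon> / 36 + B * mean_upto T w"
    using B2_uniformly_integrable[OF g \<epsilon>9(2)] by blast
  (* A mean below d makes a weight negligible against f (through delta) and against g (through B).
     Together with the 9 that normalises the weights, the term with g is at most 9 (eps/36 + eps/36). *)
  define d where "d = min \<delta> (\<epsilon> / (36 * (B + 1)))"
  have "d > 0" using \<delta>(1) \<open>\<epsilon> > 0\<close> B(1) by (simp add: d_def)
  have Bd: "B * d \<le> \<epsilon> / 36"
  proof -
    have "B * d \<le> (B + 1) * (\<epsilon> / (36 * (B + 1)))"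
      using B(1) \<open>d > 0\<close> by (intro mult_mono) (auto simp: d_def)
    also have "\<dots> = \<epsilon> / 36" using B(1) by (simp add: field_simps)
    finally show ?thesis .
  qed
  have "0 < d / 2 * (d / 2)" using \<open>d > 0\<close> by simp
  from exists_trig_poly_near_Bohr_limit[OF L2_loc(3,4) uv_close V this]
  obtain Q where Q: "trig_poly Q" "\<And>t. 0 \<le> t \<Longrightarrow> cmod (Q t) \<le> 2"
    and uQ: "\<forall>\<^sub>F T in at_top. mean_sq T (\<lambda>t. u t - Q t) \<le> d / 2 * (d / 2)"
    and vQ: "\<forall>\<^sub>F T in at_top. mean_sq T (\<lambda>t. v t - Q t) \<le> d / 2 * (d / 2)" by blast
  have [measurable]: "half_measurable Q" by (rule trig_poly_measurable[OF Q(1)])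
  (* 9 bounds the modulus of x^2 - Q^2 for unimodular x, so this is a weight with values in [0, 1]. *)
  define w where "w x t = cmod ((x t)\<^sup>2 - (Q t)\<^sup>2) / 9" for x :: "real \<Rightarrow> complex" and t
  have w_meas: "half_measurable (w x)" if [measurable]: "half_measurable x" for x
    unfolding w_def by measurable
  have w01: "0 \<le> w x t \<and> w x t \<le> 1" if "cmod (x t) = 1" "0 \<le> t" for x t
    using cmod_square_diff_le(2)[OF that(1) Q(2)[OF that(2)]] by (simp add: w_def)
  have w_mean: "\<forall>\<^sub>F T in at_top. mean_upto T (w x) \<le> d"
    if x: "x \<in> L2_loc" "\<And>t. 0 \<le> t \<Longrightarrow> cmod (x t) = 1"
      and xQ: "\<forall>\<^sub>F T in at_top. mean_sq T (\<lambda>t. x t - Q t) \<le> d / 2 * (d / 2)" for x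
    using xQ eventually_gt_at_top[of 0]
  proof eventually_elim
    case (elim T)
    have xQ2: "(\<lambda>t. x t - Q t) \<in> L2_loc" by (intro L2_loc_diff x(1) trig_poly_L2_loc Q(1))
    have "mean_upto T (w x) \<le> mean_upto T (\<lambda>t. cmod (x t - Q t))"
    proof (rule mean_upto_mono)
      show "loc_int (w x)"
        by (rule loc_int_weight[OF w_meas[OF L2_loc_measurable[OF x(1)]]]) (intro w01 x(2))
      show "w x t \<le> cmod (x t - Q t)" if "0 \<le> t" for t
        using cmod_square_diff_le(1)[OF x(2)[OF that] Q(2)[OF that]] norm_ge_zero[of "x t - Q t"]
        unfolding w_def by linarith
    qed (use elim(2) xQ2 in \<open>auto intro: loc_int_norm L2_loc_loc_int\<close>)
    also have "\<dots> \<le> d / 2 + mean_sq T (\<lambda>t. x t - Q t) / (d / 2)"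
      using \<open>d > 0\<close> elim(2) by (intro mean_norm_le_mean_sq xQ2) auto
    also have "mean_sq T (\<lambda>t. x t - Q t) / (d / 2) \<le> d / 2"
      using elim(1) \<open>d > 0\<close> by (subst pos_divide_le_eq) auto
    finally show ?case by simp
  qed
  define P where "P t = (cnj (Q t))\<^sup>2" for t
  have P: "trig_poly P"
    unfolding P_def power2_eq_square by (intro trig_poly_mult trig_poly_cnj Q(1))
  have weight: "cmod ((cnj (x t))\<^sup>2 - P t) = 9 * w x t" for x t
    unfolding P_def w_def by (simp flip: complex_cnj_power complex_cnj_diff)
  obtain b where b: "\<And>t. cmod (P t) \<le> b" using trig_poly_bounded[OF P] by blast
  have wu: "half_measurable (w u)" "\<And>t. 0 \<le> t \<Longrightarrow> 0 \<le> w u t \<and> w u t \<le> 1"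
    and wv: "half_measurable (w v)" "\<And>t. 0 \<le> t \<Longrightarrow> 0 \<le> w v t \<and> w v t \<le> 1"
    using w_meas meas w01 u1 v1 by auto
  have "\<forall>\<^sub>F T in at_top. mean_upto T (w u) \<le> \<delta>"
    by (rule eventually_mono[OF w_mean[OF L2_loc(3) _ uQ]]) (simp_all add: u1 d_def)
  from \<delta>(2)[OF wu this]
  have F1: "\<forall>\<^sub>F T in at_top. mean_upto T (\<lambda>t. (cmod (f t))\<^sup>2 * w u t) \<le> \<epsilon> / 9 * mean_sq T f" .
  have F2: "\<forall>\<^sub>F T in at_top. cmod (mean_upto T (\<lambda>t. ((f t)\<^sup>2 - (g t)\<^sup>2) * P t)) < \<epsilon> / 2"
  proof -
    have "((\<lambda>T. mean_upto T (\<lambda>t. ((f t)\<^sup>2 - (g t)\<^sup>2) * P t)) \<longlongrightarrow> 0) at_top"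
      by (rule orthogonal_e_trig_poly[OF sq _ loc_int_diff[OF loc_int_sq] P]) measurable
    from order_tendstoD(2)[OF tendsto_norm_zero[OF this], of "\<epsilon> / 2"] \<open>\<epsilon> > 0\<close> show ?thesis by simp
  qed
  have wv_mean: "\<forall>\<^sub>F T in at_top. mean_upto T (w v) \<le> d"
    by (rule w_mean[OF L2_loc(4) _ vQ]) (rule v1)
  show "\<forall>\<^sub>F T in at_top. \<bar>mean_sq T f - mean_sq T g\<bar> \<le> \<epsilon> + \<epsilon> * mean_sq T f"
    using F1 F2 B(2) wv_mean eventually_gt_at_top[of 0]
  proof eventually_elim
    case (elim T)
    have eqs: "(\<lambda>t. (cmod (f t))\<^sup>2 * cmod ((cnj (u t))\<^sup>2 - P t)) = (\<lambda>t. 9 * ((cmod (f t))\<^sup>2 * w u t))"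
      "(\<lambda>t. (cmod (g t))\<^sup>2 * cmod ((cnj (v t))\<^sup>2 - P t)) = (\<lambda>t. 9 * ((cmod (g t))\<^sup>2 * w v t))"
      by (simp_all add: weight mult.left_commute)
    have "mean_upto T (\<lambda>t. (cmod (g t))\<^sup>2 * w v t) \<le> \<epsilon> / 36 + B * mean_upto T (w v)"
      using elim(3) wv by blast
    also have "B * mean_upto T (w v) \<le> B * d" using elim(4) B(1) by (rule mult_left_mono)
    also note Bd
    finally have G: "9 * mean_upto T (\<lambda>t. (cmod (g t))\<^sup>2 * w v t) \<le> \<epsilon> / 2" by simp
    have "\<bar>mean_sq T f - mean_sq T g\<bar>
      \<le> cmod (mean_upto T (\<lambda>t. ((f t)\<^sup>2 - (g t)\<^sup>2) * P t))
        + 9 * mean_upto T (\<lambda>t. (cmod (f t))\<^sup>2 * w u t) + 9 * mean_upto T (\<lambda>t. (cmod (g t))\<^sup>2 * w v t)"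
      using mean_sq_diff_bound[OF trig_poly_measurable[OF P] b elim(5), unfolded eqs mean_upto_mult_left]
        loc_int_mult_left[OF loc_int_sq_mult_weight[OF L2_loc(1) wu], of 9]
        loc_int_mult_left[OF loc_int_sq_mult_weight[OF L2_loc(2) wv], of 9] by simp
    with G elim(1,2) show ?case by simp
  qed
qed

text \<open>
  Here \<open>P = cnj u\<^sup>2\<close> exactly. The second term of the bound disappears, and the first one vanishes in the mean because multiplication by \<open>cnj u\<close>, applied
  twice, preserves orthogonality to all frequencies; to stay within \<open>L2_loc\<close>, this is done for a truncation
  of \<open>f\<^sup>2 - g\<^sup>2\<close>.
\<close>
lemma B2_if_bounded_multiplier:
  assumes "bounded_multiplier_A2 u"
  shows "f \<in> B2"
proof (rule B2_if_mean_sq_diff_bound)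
  let ?\<psi> = "\<lambda>t. (f t)\<^sup>2 - (g t)\<^sup>2"
  define P where "P t = (cnj (u t))\<^sup>2" for t
  have P_meas [measurable]: "half_measurable P" unfolding P_def by measurable
  have P1: "cmod (P t) \<le> 1" if "0 \<le> t" for t
    using u1[OF that] by (simp add: P_def norm_power)
  have \<psi>: "half_measurable ?\<psi>" "loc_int ?\<psi>" by (measurable, rule loc_int_diff[OF loc_int_sq])
  obtain \<psi>' where \<psi>': "\<psi>' \<in> L2_loc" "((\<lambda>T. mean_upto T (\<lambda>t. cmod (?\<psi> t - \<psi>' t))) \<longlongrightarrow> 0) at_top"
    using exists_L2_loc_close_in_mean[OF \<psi>] .
  have [measurable]: "half_measurable \<psi>'" by (rule L2_loc_measurable[OF \<psi>'(1)])
  note \<psi>'_int = L2_loc_loc_int[OF \<psi>'(1)]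
  have mean_close: "((\<lambda>T. mean_upto T (\<lambda>t. ?\<psi> t * h t) - mean_upto T (\<lambda>t. \<psi>' t * h t)) \<longlongrightarrow> 0) at_top"
    if h: "half_measurable h" "\<And>t. 0 \<le> t \<Longrightarrow> cmod (h t) \<le> 1" for h
  proof (rule Lim_null_comparison[OF _ \<psi>'(2)])
    note [measurable] = h(1)
    show "\<forall>\<^sub>F T in at_top. norm (mean_upto T (\<lambda>t. ?\<psi> t * h t) - mean_upto T (\<lambda>t. \<psi>' t * h t))
        \<le> mean_upto T (\<lambda>t. cmod (?\<psi> t - \<psi>' t))"
      using eventually_gt_at_top[of 0]
    proof eventually_elim
      case (elim T)
      have le: "norm (x t * h t) \<le> norm (x t)" if "0 \<le> t" for x :: "real \<Rightarrow> complex" and t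
        using mult_left_mono[OF h(2)[OF that], of "cmod (x t)"] by (simp add: norm_mult)
      have li: "loc_int (\<lambda>t. ?\<psi> t * h t)" "loc_int (\<lambda>t. \<psi>' t * h t)"
        by (rule loc_int_bound[OF _ loc_int_norm[OF \<psi>(2)]], measurable, rule le, assumption)
          (rule loc_int_bound[OF _ loc_int_norm[OF \<psi>'_int]], measurable, rule le, assumption)
      have "mean_upto T (\<lambda>t. ?\<psi> t * h t) - mean_upto T (\<lambda>t. \<psi>' t * h t) = mean_upto T (\<lambda>t. (?\<psi> t - \<psi>' t) * h t)"
        by (simp only: left_diff_distrib[of "?\<psi> _" "\<psi>' _"] mean_upto_diff[OF li elim])
      also have "norm \<dots> \<le> mean_upto T (\<lambda>t. cmod (?\<psi> t - \<psi>' t))"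
        by (rule norm_mean_upto_le_mean[OF _ loc_int_norm[OF loc_int_diff[OF \<psi>(2) \<psi>'_int]] _ elim],
            measurable, rule le, assumption)
      finally show ?case .
    qed
  qed
  have "orthogonal_e \<psi>'"
    unfolding orthogonal_e_def has_binner_def
  proof
    fix l
    have "((\<lambda>T. mean_upto T (\<lambda>t. ?\<psi> t * cnj (e l t))) \<longlongrightarrow> 0) at_top"
      using sq by (simp add: orthogonal_e_def has_binner_def)
    from tendsto_diff[OF this mean_close[of "\<lambda>t. cnj (e l t)"]]
    show "((\<lambda>T. mean_upto T (\<lambda>t. \<psi>' t * cnj (e l t))) \<longlongrightarrow> 0) at_top"
      using half_measurable_cnj[OF e_measurable[of l]] by simp
  qed
  note o1 = orthogonal_e_cnj_multiplier[OF assms \<psi>'(1) this]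
  have "(\<lambda>t. cnj (u t) * \<psi>' t) \<in> L2_loc"
    by (rule L2_loc_mult_bounded[OF \<psi>'(1) cnj_meas(1), of 1]) (simp add: u1)
  from orthogonal_e_cnj_multiplier[OF assms this o1]
  have "has_binner (\<lambda>t. cnj (u t) * (cnj (u t) * \<psi>' t)) (e 0) 0" by (simp add: orthogonal_e_def)
  then have "((\<lambda>T. mean_upto T (\<lambda>t. \<psi>' t * P t)) \<longlongrightarrow> 0) at_top"
    by (simp add: has_binner_def e_def P_def power2_eq_square mult_ac)
  from tendsto_add[OF mean_close[OF P_meas P1] this]
  have lim: "((\<lambda>T. mean_upto T (\<lambda>t. ?\<psi> t * P t)) \<longlongrightarrow> 0) at_top" by simp
  define w where "w t = cmod ((v t)\<^sup>2 - (u t)\<^sup>2) / 9" for t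
  have w_meas: "half_measurable w" unfolding w_def by measurable
  have w01: "0 \<le> w t \<and> w t \<le> 1" and w_le: "w t \<le> cmod (u t - v t)" if "0 \<le> t" for t
    using cmod_square_diff_le[OF v1[OF that], of "u t"] u1[OF that] norm_ge_zero[of "v t - u t"]
    unfolding w_def norm_minus_commute[of "u t" "v t"] by (auto simp del: norm_ge_zero intro: norm_ge_zero)
  have uv_L2: "(\<lambda>t. u t - v t) \<in> L2_loc" by (intro L2_loc_diff L2_loc)
  have w_lim: "((\<lambda>T. mean_upto T (\<lambda>t. cmod (u t - v t))) \<longlongrightarrow> 0) at_top"
    by (rule mean_norm_tendsto_0[OF uv_L2 uv_close])
  have weight: "cmod ((cnj (v t))\<^sup>2 - P t) = 9 * w t" for t
    unfolding P_def w_def by (simp flip: complex_cnj_power complex_cnj_diff)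
  fix \<epsilon> :: real assume "\<epsilon> > 0"
  then have "\<epsilon> / 36 > 0" by simp
  obtain B where B: "B \<ge> 0"
    "\<forall>\<^sub>F T in at_top. \<forall>w. half_measurable w \<longrightarrow> (\<forall>t\<ge>0. 0 \<le> w t \<and> w t \<le> 1) \<longrightarrow>
       mean_upto T (\<lambda>t. (cmod (g t))\<^sup>2 * w t) \<le> \<epsilon> / 36 + B * mean_upto T w"
    using B2_uniformly_integrable[OF g \<open>\<epsilon> / 36 > 0\<close>] by blast
  have B_pos: "0 < \<epsilon> / (36 * (B + 1))" and "0 < \<epsilon> / 2" using \<open>\<epsilon> > 0\<close> B(1) by auto
  show "\<forall>\<^sub>F T in at_top. \<bar>mean_sq T f - mean_sq T g\<bar> \<le> \<epsilon> + \<epsilon> * mean_sq T f"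
    using order_tendstoD(2)[OF w_lim B_pos]
      order_tendstoD(2)[OF tendsto_norm_zero[OF lim] \<open>0 < \<epsilon> / 2\<close>] B(2) eventually_gt_at_top[of 0]
  proof eventually_elim
    case (elim T)
    have "mean_upto T w \<le> mean_upto T (\<lambda>t. cmod (u t - v t))"
      using elim(4)
      by (intro mean_upto_mono loc_int_weight w_meas w01 w_le loc_int_norm L2_loc_loc_int uv_L2)
    also have "\<dots> \<le> \<epsilon> / (36 * (B + 1))" using elim(1) by simp
    finally have "B * mean_upto T w \<le> (B + 1) * (\<epsilon> / (36 * (B + 1)))"
      using B(1) B_pos elim(4) w01 by (intro mult_mono mean_upto_nonneg) auto
    also have "\<dots> = \<epsilon> / 36" using B(1) by (simp add: field_simps)
    finally have Bw: "B * mean_upto T w \<le> \<epsilon> / 36" .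
    have "mean_upto T (\<lambda>t. (cmod (g t))\<^sup>2 * w t) \<le> \<epsilon> / 36 + B * mean_upto T w"
      using elim(3) w_meas w01 by blast
    with Bw have G: "9 * mean_upto T (\<lambda>t. (cmod (g t))\<^sup>2 * w t) \<le> \<epsilon> / 2" by simp
    have eqs: "(\<lambda>t. (cmod (f t))\<^sup>2 * cmod ((cnj (u t))\<^sup>2 - P t)) = (\<lambda>t. 0)"
      "(\<lambda>t. (cmod (g t))\<^sup>2 * cmod ((cnj (v t))\<^sup>2 - P t)) = (\<lambda>t. 9 * ((cmod (g t))\<^sup>2 * w t))"
      by (simp_all add: weight mult.left_commute) (simp add: P_def)
    have "\<bar>mean_sq T f - mean_sq T g\<bar>
      \<le> cmod (mean_upto T (\<lambda>t. ?\<psi> t * P t)) + 0 + 9 * mean_upto T (\<lambda>t. (cmod (g t))\<^sup>2 * w t)"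
      using mean_sq_diff_bound[OF P_meas P1 elim(4), unfolded eqs mean_upto_mult_left mean_upto_const[OF elim(4)]]
        loc_int_const[of "0 :: real"]
        loc_int_mult_left[OF loc_int_sq_mult_weight[OF L2_loc(2) w_meas w01], of 9] by simp
    moreover have "0 \<le> mean_sq T f" using elim(4) by (intro mean_upto_nonneg) auto
    ultimately show ?case using G elim(2) \<open>\<epsilon> > 0\<close> by (simp add: add_increasing2)
  qed
qed

end

theorem proposition5:
  fixes f g :: "real \<Rightarrow> complex" and \<theta>f \<theta>g :: "real \<Rightarrow> real"
    and gN :: "nat \<Rightarrow> real \<Rightarrow> complex" and \<theta>gN :: "nat \<Rightarrow> real \<Rightarrow> real"
  assumes "g \<in> B2" and "f \<in> L2_loc"
    and "\<forall>l. \<exists>c. has_binner f (e l) c \<and> has_binner g (e l) c"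
    and "\<forall>l. \<exists>c. has_binner (\<lambda>t. (f t)\<^sup>2) (e l) c \<and> has_binner (\<lambda>t. (g t)\<^sup>2) (e l) c"
    and "is_arg \<theta>f f" and "is_arg \<theta>g g" and "\<forall>N. is_arg (\<theta>gN N) (gN N)"
    and "(\<lambda>t. cis (\<theta>f t)) \<in> U" and "(\<lambda>t. cis (\<theta>g t)) \<in> U"
    and "\<forall>l. \<exists>c. has_binner (\<lambda>t. cis (\<theta>f t)) (e l) c \<and> has_binner (\<lambda>t. cis (\<theta>g t)) (e l) c"
    and "\<forall>N. (\<lambda>t. cis (\<theta>gN N t)) \<in> Bohr"
    and "converges_in_B2 (\<lambda>N t. cis (\<theta>gN N t)) (\<lambda>t. cis (\<theta>g t))"
  shows "(\<not> has_bnorm f 0 \<longrightarrow> (f \<in> B2 \<longleftrightarrow> not_CNS f)) \<and>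
         (bounded_multiplier_A2 (\<lambda>t. cis (\<theta>f t)) \<and> bounded_multiplier_A2 (\<lambda>t. cis (\<theta>g t))
            \<longrightarrow> f \<in> B2)"
proof -
  note L2 = assms(2) B2_L2_loc[OF assms(1)]
  have uB2: "(\<lambda>t. cis (\<theta>f t)) \<in> B2" and vB2: "(\<lambda>t. cis (\<theta>g t)) \<in> B2"
    using assms(8,9) by (auto simp: U_def)
  note meas = L2[THEN L2_loc_measurable]
  have sq_int: "loc_int (\<lambda>t. (f t)\<^sup>2)" "loc_int (\<lambda>t. (g t)\<^sup>2)"
    unfolding power2_eq_square by (intro L2_loc_loc_int_mult L2)+
  interpret polar_pair f g "\<lambda>t. cis (\<theta>f t)" "\<lambda>t. cis (\<theta>g t)"
  proof
    show "orthogonal_e (\<lambda>t. f t - g t)"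
      by (intro orthogonal_e_diff meas L2_loc_loc_int L2 assms(3))
    show "orthogonal_e (\<lambda>t. (f t)\<^sup>2 - (g t)\<^sup>2)"
      by (intro orthogonal_e_diff sq_int assms(4) borel_measurable_power meas)
    show "orthogonal_e (\<lambda>t. cis (\<theta>f t) - cis (\<theta>g t))"
      using uB2 vB2 by (intro orthogonal_e_diff L2_loc_measurable L2_loc_loc_int B2_L2_loc assms(10))
  qed (use assms(1,2,5,6) uB2 vB2 in \<open>auto simp: is_arg_def\<close>)
  show ?thesis
  proof (intro conjI impI iffI)
    show "not_CNS f" if "\<not> has_bnorm f 0" "f \<in> B2"
      using that by (intro B2_imp_not_CNS)
    show "f \<in> B2" if "\<not> has_bnorm f 0" "not_CNS f"
      by (rule B2_if_not_CNS[OF that(2,1), of "\<lambda>N t. cis (\<theta>gN N t)"]) (use assms(11,12) in auto)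
    show "f \<in> B2" if "bounded_multiplier_A2 (\<lambda>t. cis (\<theta>f t)) \<and> bounded_multiplier_A2 (\<lambda>t. cis (\<theta>g t))"
      using that by (intro B2_if_bounded_multiplier) simp
  qed
qed

end
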